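(* Let $\mathcal{H}_1,\mathcal{H}_2,\mathcal{H}_3,\mathcal{H}_4$ be separable Hilbert spaces, $r\in\mathbb{N}$, $M\in L_2(\mathcal{H}_1,\mathcal{H}_4)$, $B\in\mathcal{B}(\mathcal{H}_3,\mathcal{H}_4)$, $C\in\mathcal{B}(\mathcal{H}_1,\mathcal{H}_2)$. Put $K:=P_{\overline{\operatorname{ran}B}}MP_{(\ker C)^\perp}$ and assume that the set $\mathcal{Y}_r$ defined in the context is nonempty. For any $\hat X=B^\dagger(K)_rC^\dagger:\operatorname{dom}(C^\dagger)\to\mathcal{H}_3$ with $(K)_r\in\mathcal{Y}_r$, it holds that $$\|M-B\hat XC\|_{L_2}^2=\|M\|_{L_2}^2-\Delta,\qquad \Delta:=\sum_{i\le r}|\sigma_i(K)|^2 .$$ We have $$\Delta=\sum_{i\le r}\sigma_i\big(P_{\overline{\operatorname{ran}B}}MC^\dagger CM^*P_{\overline{\operatorname{ran}B}}\big)=\sum_{i\le r}\sigma_i\big(C^\dagger CM^*P_{\overline{\operatorname{ran}B}}MC^\dagger C\big).$$ If additionally $\operatorname{ran}M\subset\operatorname{dom}(B^\dagger)$, then $B^\dagger MC^\dagger CM^*B$ has only nonnegative eigenvalues and $$\Delta=\sum_{i\le r}\lambda_i(B^\dagger MC^\dagger CM^*B),$$ where $\lambda_i(\cdot)$ denotes the $i$-th largest eigenvalue.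
   Context: All Hilbert spaces are over a common field $\mathbb{R}$ or $\mathbb{C}$ and may be finite- or infinite-dimensional. $\mathcal{B}(\mathcal{H},\mathcal{K})$ denotes the bounded everywhere-defined operators, $L_2(\mathcal{H},\mathcal{K})$ the Hilbert--Schmidt operators with norm $\|\cdot\|_{L_2}$, and $\mathcal{B}_{00,r}(\mathcal{H},\mathcal{K})$ the bounded operators with range of dimension at most $r$. $P_V$ is the orthogonal projector onto a closed subspace $V$. Moore--Penrose inverse: for $T\in\mathcal{B}(\mathcal{H},\mathcal{K})$, $T^\dagger$ is the (possibly unbounded) linear operator with $\operatorname{dom}(T^\dagger)=\operatorname{ran}T\oplus(\operatorname{ran}T)^\perp$ and $T^\dagger(h+k)=(T|_{(\ker T)^\perp})^{-1}h$ for $h\in\operatorname{ran}T$, $k\in(\operatorname{ran}T)^\perp$. In particular $C^\dagger C=P_{(\ker C)^\perp}$. $\sigma_i(T)$ is the $i$-th largest singular value of a compact operator $T$; singular values and eigenvalues are counted with multiplicity and set to $0$ for indices beyond the number of (nonzero) ones. A rank-$r$ truncated SVD $(T)_r$ of $T=\sum_i\sigma_i\langle\cdot,e_i\rangle f_i$ keeps the first $r$ terms (not unique in general). $\mathcal{Y}_r=\{Y\in\mathcal{B}_{00,r}(\mathcal{H}_1,\mathcal{H}_4):\ \operatorname{ran}Y\subset\operatorname{dom}(B^\dagger),\ \|K-Y\|_{L_2}\le\|K-\tilde Y\|_{L_2}\ \forall\,\tilde Y\in\mathcal{B}_{00,r}(\mathcal{H}_1,\mathcal{H}_4)\}$; it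 consists of the rank-$r$ truncated SVDs $(K)_r$ of $K$ that map into $\operatorname{dom}(B^\dagger)$. *)

theory Defs
  imports "HOL-Analysis.Analysis"
begin

text \<open>
  The common scalar field.  By the two axioms every scalar is a root of a real quadratic
  polynomial, so the real numbers (with trivial conjugation) and the complex numbers
  (with \<open>cnj\<close>) are, up to isomorphism, the only instances.
\<close>

class real_or_complex = real_normed_field +
  fixes conj :: "'a \<Rightarrow> 'a"
  assumes conj_add: "conj (x + y) = conj x + conj y"
    and mult_conj_self: "x * conj x = (norm x)\<^sup>2 *\<^sub>R 1"

instantiation real :: real_or_complex
begin
definition conj_real :: "real \<Rightarrow> real" where "conj_real x = x"
instance by standard (auto simp: conj_real_def power2_eq_square)
end

instantiation complex :: real_or_complex
begin
definition conj_complex :: "complex \<Rightarrow> complex" where "conj_complex = cnj"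
instance by standard (auto simp: conj_complex_def complex_norm_square scaleR_conv_of_real
    simp flip: of_real_power)
end

text \<open>
  A Hilbert space over \<open>'k\<close> has a type \<open>'a\<close> of class \<open>banach\<close> as its underlying complete normed
  space; the record supplies the scalar multiplication (which extends \<open>scaleR\<close>) and the inner
  product (linear in the first argument) that induces the given norm.
\<close>

record ('k, 'a) hilbert =
  scal :: "'k \<Rightarrow> 'a \<Rightarrow> 'a"
  ip :: "'a \<Rightarrow> 'a \<Rightarrow> 'k"

locale hilbert_space = vector_space "scal H"
  for H :: "('k::real_or_complex, 'a::banach) hilbert" +
  assumes scal_of_real: "scal H (of_real t) x = t *\<^sub>R x"
    and ip_add_left: "ip H (x + y) z = ip H x z + ip H y z"
    and ip_scal_left: "ip H (scal H c x) y = c * ip H x y"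
    and ip_commute: "ip H y x = conj (ip H x y)"
    and ip_self: "ip H x x = of_real ((norm x)\<^sup>2)"

lemma hilbert_space_real:
  "hilbert_space \<lparr>scal = scaleR, ip = (inner :: 'a::{real_inner, banach} \<Rightarrow> _)\<rparr>"
  by unfold_locales
    (auto simp: algebra_simps inner_commute conj_real_def power2_norm_eq_inner)

lemma hilbert_space_complex:
  "hilbert_space \<lparr>scal = (*), ip = (\<lambda>x y. x * cnj y)\<rparr>"
  by unfold_locales
    (auto simp: algebra_simps conj_complex_def complex_norm_square scaleR_conv_of_real
      simp flip: of_real_power)

definition bounded_ops ::
    "('k::real_or_complex, 'a::banach) hilbert \<Rightarrow> ('k, 'b::banach) hilbert \<Rightarrow> ('a \<Rightarrow> 'b) set" where
  "bounded_ops H K = {T. Vector_Spaces.linear (scal H) (scal K) T \<and> bounded_linear T}"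

definition ker :: "('a \<Rightarrow> 'b::zero) \<Rightarrow> 'a set" where
  "ker T = {x. T x = 0}"

definition orth_compl :: "('k::real_or_complex, 'a::banach) hilbert \<Rightarrow> 'a set \<Rightarrow> 'a set" where
  "orth_compl H V = {x. \<forall>v\<in>V. ip H x v = 0}"

definition orth_proj :: "('k::real_or_complex, 'a::banach) hilbert \<Rightarrow> 'a set \<Rightarrow> 'a \<Rightarrow> 'a" where
  "orth_proj H V x = (THE p. p \<in> V \<and> x - p \<in> orth_compl H V)"

definition adj ::
    "('k::real_or_complex, 'a::banach) hilbert \<Rightarrow> ('k, 'b::banach) hilbert \<Rightarrow> ('a \<Rightarrow> 'b) \<Rightarrow> 'b \<Rightarrow> 'a"
  where "adj H K T y = (THE z. \<forall>x. ip K (T x) y = ip H x z)"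

text \<open>Unlike \<open>vector_space.dim\<close>, this never holds for an infinite-dimensional \<open>V\<close>.\<close>

definition has_dim :: "('k::real_or_complex, 'a::banach) hilbert \<Rightarrow> 'a set \<Rightarrow> nat \<Rightarrow> bool" where
  "has_dim H V n \<longleftrightarrow> (\<exists>S. finite S \<and> card S = n \<and> \<not> module.dependent (scal H) S \<and>
                          module.span (scal H) S = V)"

definition rank_le_ops ::
    "('k::real_or_complex, 'a::banach) hilbert \<Rightarrow> ('k, 'b::banach) hilbert \<Rightarrow> nat \<Rightarrow> ('a \<Rightarrow> 'b) set"
  where "rank_le_ops H K r = {T \<in> bounded_ops H K. \<exists>n\<le>r. has_dim K (range T) n}"

definition is_onb :: "('k::real_or_complex, 'a::banach) hilbert \<Rightarrow> 'a set \<Rightarrow> bool" where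
  "is_onb H E \<longleftrightarrow> (\<forall>e\<in>E. \<forall>f\<in>E. ip H e f = (if e = f then 1 else 0)) \<and>
                  closure (module.span (scal H) E) = UNIV"

text \<open>
  Every Hilbert space has an orthonormal basis, and neither the finiteness nor the value of
  the sum of the \<open>(norm (T e))\<^sup>2\<close> depends on the choice of it.
\<close>

definition some_onb :: "('k::real_or_complex, 'a::banach) hilbert \<Rightarrow> 'a set" where
  "some_onb H = (SOME E. is_onb H E)"

definition hs_ops ::
    "('k::real_or_complex, 'a::banach) hilbert \<Rightarrow> ('k, 'b::banach) hilbert \<Rightarrow> ('a \<Rightarrow> 'b) set" where
  "hs_ops H K = {T \<in> bounded_ops H K. (\<lambda>e. (norm (T e))\<^sup>2) summable_on some_onb H}"

definition hs_norm ::
    "('k::real_or_complex, 'a::banach) hilbert \<Rightarrow> ('a \<Rightarrow> 'b::banach) \<Rightarrow> real" where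
  "hs_norm H T = sqrt (\<Sum>\<^sub>\<infinity>e\<in>some_onb H. (norm (T e))\<^sup>2)"

text \<open>
  The Moore--Penrose inverse of a bounded operator is in general only defined on the subspace
  \<open>pinv_dom\<close>; the values of the total function \<open>pinv\<close> outside of it have no meaning.
\<close>

definition pinv_dom ::
    "('k::real_or_complex, 'a::banach) hilbert \<Rightarrow> ('k, 'b::banach) hilbert \<Rightarrow> ('a \<Rightarrow> 'b) \<Rightarrow> 'b set"
  where "pinv_dom H K T = {h + k | h k. h \<in> range T \<and> k \<in> orth_compl K (range T)}"

definition pinv ::
    "('k::real_or_complex, 'a::banach) hilbert \<Rightarrow> ('k, 'b::banach) hilbert \<Rightarrow> ('a \<Rightarrow> 'b) \<Rightarrow> 'b \<Rightarrow> 'a"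
  where "pinv H K T y =
    (THE x. x \<in> orth_compl H (ker T) \<and> (\<exists>k\<in>orth_compl K (range T). y = T x + k))"

definition is_eigenvalue ::
    "('k::real_or_complex, 'a::banach) hilbert \<Rightarrow> ('a \<Rightarrow> 'a) \<Rightarrow> 'k \<Rightarrow> bool" where
  "is_eigenvalue H T \<mu> \<longleftrightarrow> (\<exists>x. x \<noteq> 0 \<and> T x = scal H \<mu> x)"

definition gen_eigenspace ::
    "('k::real_or_complex, 'a::banach) hilbert \<Rightarrow> ('a \<Rightarrow> 'a) \<Rightarrow> 'k \<Rightarrow> 'a set" where
  "gen_eigenspace H T \<mu> = {x. \<exists>n. ((\<lambda>x. T x - scal H \<mu> x) ^^ n) x = 0}"

text \<open>
  \<open>eigval H T i\<close> is the \<open>(i + 1)\<close>-st largest eigenvalue of \<open>T\<close>, i.e. indices start at 0.  The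
  positive eigenvalues are listed in nonincreasing order, each as often as its algebraic
  multiplicity says, and the list is filled up with zeros.  The definition is meant for operators
  with nonnegative eigenvalues only, of which finitely many (with multiplicity) exceed any given
  positive bound.
\<close>

definition is_eigval_seq ::
    "('k::real_or_complex, 'a::banach) hilbert \<Rightarrow> ('a \<Rightarrow> 'a) \<Rightarrow> (nat \<Rightarrow> real) \<Rightarrow> bool" where
  "is_eigval_seq H T f \<longleftrightarrow> decseq f \<and> (\<forall>i. 0 \<le> f i) \<and>
     (\<forall>t>0. finite {i. f i = t} \<and>
             has_dim H (gen_eigenspace H T (of_real t)) (card {i. f i = t}))"

definition eigval ::
    "('k::real_or_complex, 'a::banach) hilbert \<Rightarrow> ('a \<Rightarrow> 'a) \<Rightarrow> nat \<Rightarrow> real" where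
  "eigval H T = (THE f. is_eigval_seq H T f)"

text \<open>Singular values, again with indices starting at 0.\<close>

definition sing_val ::
    "('k::real_or_complex, 'a::banach) hilbert \<Rightarrow> ('k, 'b::banach) hilbert \<Rightarrow> ('a \<Rightarrow> 'b) \<Rightarrow> nat \<Rightarrow> real"
  where "sing_val H K T i = sqrt (eigval H (adj H K T \<circ> T) i)"

definition best_approx ::
    "('k::real_or_complex, 'a::banach) hilbert \<Rightarrow> ('k, 'c::banach) hilbert \<Rightarrow>
     ('k, 'd::banach) hilbert \<Rightarrow> nat \<Rightarrow> ('c \<Rightarrow> 'd) \<Rightarrow> ('a \<Rightarrow> 'd) \<Rightarrow> ('a \<Rightarrow> 'd) set" where
  "best_approx H1 H3 H4 r B K =
     {Y \<in> rank_le_ops H1 H4 r. range Y \<subseteq> pinv_dom H3 H4 B \<and>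
        (\<forall>Z\<in>rank_le_ops H1 H4 r. hs_norm H1 (\<lambda>x. K x - Y x) \<le> hs_norm H1 (\<lambda>x. K x - Z x))}"

end

theory Submission
  imports Defs
begin

text \<open>
  Since \<open>B X C = P Y Q\<close> with the projections \<open>P\<close> and \<open>Q = C\<^sup>\<dagger> C\<close>, Pythagoras in the
  Hilbert--Schmidt norm reduces the first claim to the Eckart--Young theorem for \<open>K = P M Q\<close>.
  That theorem follows from Ky Fan's inequality for an orthonormal list of eigenvectors of
  \<open>K K\<^sup>*\<close>; the list is built greedily, each vector being a fixed point obtained by power iteration
  on the orthogonal complement of the earlier ones.  The operators in the remaining formulas for
  \<open>\<Delta>\<close> are \<open>K K\<^sup>*\<close>, \<open>K\<^sup>* K\<close> and \<open>B\<^sup>\<dagger> M Q M\<^sup>* B = G F\<close> with \<open>F G = K\<^sup>* K\<close>; for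
  \<open>t > 0\<close> the generalized eigenspaces of \<open>F G\<close> and \<open>G F\<close> have the same dimension as soon as
  \<open>F G\<close> is self-adjoint.
\<close>

section \<open>The scalar field\<close>

text \<open>The given \<open>Y\<close> is optimal among all operators of rank at most
  \<open>r\<close>, but nothing says that it equals \<open>P Y Q\<close>, and \<open>B X C\<close>
  sees only \<open>P Y Q\<close>. Both compressions contract the Hilbert--Schmidt norm, fix
  \<open>K\<close> and preserve the rank bound, so \<open>P Y Q\<close> is optimal as well, and the
  minimal value alone determines the error. The list is taken for \<open>K K\<^sup>*\<close> because
  truncation is then a projection applied after \<open>K\<close>, where Pythagoras holds at every
  single basis vector. \<open>eigval\<close> and \<open>sing_val\<close> are definite descriptions
  of whole sequences with algebraic multiplicities. Evaluating them takes three facts: such a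
  sequence is unique, the greedy list exhausts each eigenspace of a positive eigenvalue, and no
  Jordan chains occur there. The Moore--Penrose inverse may be unbounded, so the passage from
  \<open>F G\<close> to \<open>G F\<close> is kept to pure linear algebra.\<close>

lemma conj_0 [simp]: "conj (0 :: 'k::real_or_complex) = 0"
  using conj_add[of "0::'k" 0] by simp

text \<open>In a field the class axiom on \<open>x * conj x\<close> determines \<open>conj\<close>
  completely. This formula yields laws absent from the class: compatibility with real scalars, norms
  and products.\<close>

lemma conj_eq_divide: "conj x = of_real ((norm x)\<^sup>2) / x" for x :: "'k::real_or_complex"
  using mult_conj_self[of x] by (cases "x = 0") (auto simp: field_simps scaleR_conv_of_real)

lemma conj_of_real [simp]: "conj (of_real t :: 'k::real_or_complex) = of_real t"
  by (cases "t = 0") (auto simp: conj_eq_divide power2_eq_square)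

lemma norm_conj [simp]: "norm (conj x) = norm x" for x :: "'k::real_or_complex"
  by (cases "x = 0") (auto simp: conj_eq_divide norm_divide power2_eq_square norm_mult)

lemma conj_mult: "conj (x * y) = conj x * conj y" for x y :: "'k::real_or_complex"
  by (simp add: conj_eq_divide norm_mult power_mult_distrib)

lemma conj_eq_0_iff [simp]: "conj x = 0 \<longleftrightarrow> x = 0" for x :: "'k::real_or_complex"
  by (metis norm_conj norm_eq_zero)

lemma conj_conj [simp]: "conj (conj x) = x" for x :: "'k::real_or_complex"
proof (cases "x = 0")
  case False
  have "conj x * conj (conj x) = conj x * x"
    using mult_conj_self[of x] mult_conj_self[of "conj x"] by (simp add: mult.commute)
  with False show ?thesis by simp
qed simp

lemma mult_conj: "x * conj x = of_real ((norm x)\<^sup>2)" for x :: "'k::real_or_complex"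
  by (simp add: mult_conj_self scaleR_conv_of_real)

section \<open>Hilbert spaces\<close>

context hilbert_space
begin

lemma ip_add_right: "ip H x (y + z) = ip H x y + ip H x z"
  unfolding ip_commute[of x "y + z"] ip_commute[of x y] ip_commute[of x z]
  by (simp add: ip_add_left conj_add)

lemma ip_scal_right: "ip H x (scal H c y) = conj c * ip H x y"
  unfolding ip_commute[of x "scal H c y"] ip_commute[of x y]
  by (simp add: ip_scal_left conj_mult)

lemma ip_zero_left [simp]: "ip H 0 x = 0"
  using ip_add_left[of 0 0 x] by simp

lemma ip_zero_right [simp]: "ip H x 0 = 0"
  using ip_add_right[of x 0 0] by simp

lemma ip_minus_left: "ip H (- x) y = - ip H x y"
  using ip_add_left[of x "- x" y] by (simp add: eq_neg_iff_add_eq_0 add.commute)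

lemma ip_minus_right: "ip H x (- y) = - ip H x y"
  using ip_add_right[of x y "- y"] by (simp add: eq_neg_iff_add_eq_0 add.commute)

lemma ip_diff_left: "ip H (x - y) z = ip H x z - ip H y z"
  using ip_add_left[of x "- y" z] by (simp add: ip_minus_left)

lemma ip_diff_right: "ip H x (y - z) = ip H x y - ip H x z"
  using ip_add_right[of x y "- z"] by (simp add: ip_minus_right)

lemma ip_sum_left: "ip H (\<Sum>i\<in>I. f i) y = (\<Sum>i\<in>I. ip H (f i) y)"
  by (induction I rule: infinite_finite_induct) (auto simp: ip_add_left)

lemma ip_eq_0_commute: "ip H x y = 0 \<longleftrightarrow> ip H y x = 0"
  unfolding ip_commute[of y x] by simp

lemma norm_ip_commute: "norm (ip H x y) = norm (ip H y x)"
  unfolding ip_commute[of y x] by simp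

lemma norm_scal: "norm (scal H c x) = norm c * norm x"
proof -
  have "of_real ((norm (scal H c x))\<^sup>2) = (of_real ((norm c * norm x)\<^sup>2) :: 'k)"
    unfolding ip_self[symmetric] ip_scal_left ip_scal_right
    using mult_conj[of c] by (simp add: ip_self power_mult_distrib mult.commute[of "conj c"] flip: mult.assoc)
  then have "(norm (scal H c x))\<^sup>2 = (norm c * norm x)\<^sup>2"
    by (simp only: of_real_eq_iff)
  then show ?thesis by (simp add: power2_eq_iff_nonneg)
qed

lemma scal_scaleR: "scal H c (t *\<^sub>R x) = t *\<^sub>R scal H c x"
  using scale_left_commute[of c "of_real t" x] by (simp only: scal_of_real)

lemma pythagoras:
  assumes "ip H x y = 0"
  shows "(norm (x + y))\<^sup>2 = (norm x)\<^sup>2 + (norm y)\<^sup>2"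
proof -
  have "of_real ((norm (x + y))\<^sup>2) = (of_real ((norm x)\<^sup>2 + (norm y)\<^sup>2) :: 'k)"
    using assms ip_eq_0_commute[of x y]
    by (simp only: ip_self[symmetric] ip_add_left ip_add_right of_real_add) simp
  then show ?thesis by (simp only: of_real_eq_iff)
qed

lemma norm_diff_sq:
  assumes "ip H x y = of_real t"
  shows "(norm (x - y))\<^sup>2 = (norm x)\<^sup>2 + (norm y)\<^sup>2 - 2 * t"
proof -
  have "ip H y x = of_real t" using assms ip_commute[of y x] by simp
  then have "of_real ((norm (x - y))\<^sup>2) = (of_real ((norm x)\<^sup>2 + (norm y)\<^sup>2 - 2 * t) :: 'k)"
    using assms
    by (simp only: ip_self[symmetric] ip_diff_left ip_diff_right of_real_add of_real_diff) simp
  then show ?thesis by (simp only: of_real_eq_iff)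
qed

lemma parallelogram: "(norm (x + y))\<^sup>2 + (norm (x - y))\<^sup>2 = 2 * (norm x)\<^sup>2 + 2 * (norm y)\<^sup>2"
  for x y :: 'a
proof -
  have "of_real ((norm (x + y))\<^sup>2 + (norm (x - y))\<^sup>2)
      = (of_real (2 * (norm x)\<^sup>2 + 2 * (norm y)\<^sup>2) :: 'k)"
    unfolding of_real_add of_real_mult ip_self[symmetric]
    by (simp only: ip_diff_left ip_diff_right ip_add_left ip_add_right) (simp add: algebra_simps)
  then show ?thesis by (simp only: of_real_eq_iff)
qed

text \<open>The subtracted vector is the orthogonal component of \<open>x\<close> along
  \<open>y\<close>. Nonnegativity of the left side is Cauchy--Schwarz; in the projection theorem the
  same component supplies the competitor that excludes a nonorthogonal minimizer.\<close>

lemma norm_diff_component_sq: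
  assumes "y \<noteq> 0"
  shows "(norm (x - scal H (ip H x y / of_real ((norm y)\<^sup>2)) y))\<^sup>2
           = (norm x)\<^sup>2 - (norm (ip H x y))\<^sup>2 / (norm y)\<^sup>2"
proof -
  define c where "c = ip H x y / of_real ((norm y)\<^sup>2)"
  have "conj c * ip H x y = conj c * c * of_real ((norm y)\<^sup>2)"
    using assms by (simp add: c_def)
  also have "\<dots> = of_real ((norm c)\<^sup>2 * (norm y)\<^sup>2)"
    using mult_conj[of c] by (simp add: mult.commute)
  finally have "ip H x (scal H c y) = of_real ((norm c)\<^sup>2 * (norm y)\<^sup>2)"
    by (simp add: ip_scal_right)
  from norm_diff_sq[OF this] have "(norm (x - scal H c y))\<^sup>2 = (norm x)\<^sup>2 - (norm c)\<^sup>2 * (norm y)\<^sup>2"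
    by (simp add: norm_scal power_mult_distrib)
  also have "(norm c)\<^sup>2 * (norm y)\<^sup>2 = (norm (ip H x y))\<^sup>2 / (norm y)\<^sup>2"
    using assms by (simp add: c_def norm_divide norm_power power_divide) (simp add: power2_eq_square power4_eq_xxxx)
  finally show ?thesis unfolding c_def .
qed

lemma cauchy_schwarz: "norm (ip H x y) \<le> norm x * norm y"
proof (cases "y = 0")
  case False
  have "(norm (ip H x y))\<^sup>2 / (norm y)\<^sup>2 \<le> (norm x)\<^sup>2"
    using norm_diff_component_sq[OF False, of x] by (metis diff_ge_0_iff_ge zero_le_power2)
  then have "(norm (ip H x y))\<^sup>2 \<le> (norm x * norm y)\<^sup>2"
    using False by (simp add: field_simps power_mult_distrib)
  then show ?thesis by (rule power2_le_imp_le) simp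
qed simp

lemma ip_scaleR_left: "ip H (t *\<^sub>R x) y = t *\<^sub>R ip H x y"
  by (simp add: scaleR_conv_of_real ip_scal_left flip: scal_of_real)

lemma ip_scaleR_right: "ip H x (t *\<^sub>R y) = t *\<^sub>R ip H x y"
  by (simp add: scaleR_conv_of_real ip_scal_right flip: scal_of_real)

lemma bounded_linear_ip_left: "bounded_linear (\<lambda>x. ip H x y)"
  by (rule bounded_linear_intro[where K = "norm y"])
     (auto simp: ip_add_left ip_scaleR_left cauchy_schwarz)

lemma bounded_linear_ip_right: "bounded_linear (\<lambda>y. ip H x y)"
  by (rule bounded_linear_intro[where K = "norm x"])
     (auto simp: ip_add_right ip_scaleR_right cauchy_schwarz mult.commute[of _ "norm x"])

lemma bounded_linear_scal: "bounded_linear (scal H c)"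
  by (rule bounded_linear_intro[where K = "norm c"])
     (auto simp: scale_right_distrib scal_scaleR norm_scal mult.commute)

lemma eq_zeroI: "(\<And>y. ip H x y = 0) \<Longrightarrow> x = 0"
  using ip_self[of x] by simp

lemma eqI_ip: "(\<And>z. ip H x z = ip H y z) \<Longrightarrow> x = y"
  using eq_zeroI[of "x - y"] by (simp add: ip_diff_left)

section \<open>Closed subspaces, orthogonal complements and the projection theorem\<close>

lemma subspace_closure: "subspace V \<Longrightarrow> subspace (closure V)"
proof (rule subspaceI)
  assume V: "subspace V"
  show "0 \<in> closure V" using subspace_0[OF V] closure_subset by blast
  show "x + y \<in> closure V" if xy: "x \<in> closure V" "y \<in> closure V" for x y
  proof -
    obtain f g where "\<And>n. f n \<in> V" "f \<longlonglongrightarrow> x" "\<And>n. g n \<in> V" "g \<longlonglongrightarrow> y"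
      using xy unfolding closure_sequential by auto
    then show ?thesis unfolding closure_sequential
      by (intro exI[of _ "\<lambda>n. f n + g n"] conjI allI tendsto_add subspace_add[OF V])
  qed
  show "scal H c x \<in> closure V" if x: "x \<in> closure V" for c x
  proof -
    obtain f where "\<And>n. f n \<in> V" "f \<longlonglongrightarrow> x"
      using x unfolding closure_sequential by auto
    then show ?thesis unfolding closure_sequential
      by (intro exI[of _ "\<lambda>n. scal H c (f n)"] conjI allI subspace_scale[OF V]
          bounded_linear.tendsto[OF bounded_linear_scal])
  qed
qed

lemma subspace_orth_compl: "subspace (orth_compl H V)"
  by (rule subspaceI) (auto simp: orth_compl_def ip_add_left ip_scal_left)

lemma closed_orth_compl: "closed (orth_compl H V)"
proof -
  have "orth_compl H V = (\<Inter>v\<in>V. {x. ip H x v = 0})"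
    by (auto simp: orth_compl_def)
  also have "closed \<dots>"
    by (intro closed_INT ballI closed_Collect_eq continuous_on_const
        linear_continuous_on[OF bounded_linear_ip_left])
  finally show ?thesis .
qed

lemma orth_compl_closure: "orth_compl H (closure V) = orth_compl H V"
proof
  show "orth_compl H V \<subseteq> orth_compl H (closure V)"
  proof
    fix x assume x: "x \<in> orth_compl H V"
    have "closure V \<subseteq> {v. ip H x v = 0}"
      using x by (intro closure_minimal closed_Collect_eq continuous_on_const
        linear_continuous_on[OF bounded_linear_ip_right]) (auto simp: orth_compl_def)
    then show "x \<in> orth_compl H (closure V)" by (auto simp: orth_compl_def)
  qed
qed (use closure_subset[of V] in \<open>auto simp: orth_compl_def\<close>)

lemma orth_compl_span: "orth_compl H (span S) = orth_compl H S"
proof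
  show "orth_compl H S \<subseteq> orth_compl H (span S)"
  proof
    fix x assume x: "x \<in> orth_compl H S"
    have "subspace {v. ip H x v = 0}"
      by (rule subspaceI) (auto simp: ip_add_right ip_scal_right)
    then have "span S \<subseteq> {v. ip H x v = 0}"
      using x by (intro span_minimal) (auto simp: orth_compl_def)
    then show "x \<in> orth_compl H (span S)" by (auto simp: orth_compl_def)
  qed
qed (use span_superset[of S] in \<open>auto simp: orth_compl_def\<close>)

lemma orth_compl_disjoint: "x \<in> V \<Longrightarrow> x \<in> orth_compl H V \<Longrightarrow> x = 0"
  using ip_self[of x] by (auto simp: orth_compl_def)

text \<open>The midpoint of two members of \<open>V\<close> is again in \<open>V\<close>, hence at
  squared distance at least \<open>d\<close> from \<open>x\<close>; the parallelogram law turns this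
  into a bound on \<open>f m - f n\<close> by the excess of the two squared distances over
  \<open>d\<close>.\<close>

lemma minimizing_sequence_Cauchy:
  assumes V: "subspace V" and f: "\<And>n. f n \<in> V"
    and d: "\<And>v. v \<in> V \<Longrightarrow> d \<le> (norm (x - v))\<^sup>2"
    and lim: "(\<lambda>n. (norm (x - f n))\<^sup>2) \<longlonglongrightarrow> d"
  shows "Cauchy f"
proof (rule metric_CauchyI)
  fix e :: real assume e: "e > 0"
  have est: "(norm (f m - f n))\<^sup>2 \<le> 2 * (norm (x - f m))\<^sup>2 + 2 * (norm (x - f n))\<^sup>2 - 4 * d" for m n
  proof -
    let ?v = "(1/2) *\<^sub>R (f m + f n)"
    have "?v \<in> V"
      using subspace_scale[OF V subspace_add[OF V f f], of "of_real (1/2)" m n] scal_of_real by metis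
    then have "4 * d \<le> 4 * (norm (x - ?v))\<^sup>2" using d by simp
    also have "\<dots> = (norm (2 *\<^sub>R (x - ?v)))\<^sup>2" by (simp add: power_mult_distrib)
    also have "2 *\<^sub>R (x - ?v) = (x - f m) + (x - f n)"
      by (simp add: scaleR_2 algebra_simps)
    finally have "4 * d \<le> (norm ((x - f m) + (x - f n)))\<^sup>2" .
    moreover have "(norm (f m - f n))\<^sup>2 = (norm ((x - f m) - (x - f n)))\<^sup>2"
      by (simp add: norm_minus_commute)
    ultimately show ?thesis using parallelogram[of "x - f m" "x - f n"] by linarith
  qed
  \<comment> \<open>The excess enters \<open>est\<close> with factor 2 at each of the two indices,
    so a quarter of \<open>e\<^sup>2\<close> at each adds up to \<open>e\<^sup>2\<close>.\<close>
  have "eventually (\<lambda>n. (norm (x - f n))\<^sup>2 < d + e\<^sup>2 / 4) sequentially"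
    using order_tendstoD(2)[OF lim, of "d + e\<^sup>2 / 4"] e by simp
  then obtain N where N: "\<And>n. n \<ge> N \<Longrightarrow> (norm (x - f n))\<^sup>2 < d + e\<^sup>2 / 4"
    by (auto simp: eventually_sequentially)
  have "norm (f m - f n) < e" if "m \<ge> N" "n \<ge> N" for m n
  proof -
    have "(norm (f m - f n))\<^sup>2 < e\<^sup>2" using est[of m n] N[OF that(1)] N[OF that(2)] by linarith
    then show ?thesis using e by (simp add: power2_less_imp_less)
  qed
  then show "\<exists>M. \<forall>m\<ge>M. \<forall>n\<ge>M. dist (f m) (f n) < e" by (auto simp: dist_norm)
qed

theorem projection_exists:
  assumes V: "subspace V" and cl: "closed V"
  shows "\<exists>p\<in>V. x - p \<in> orth_compl H V"
proof -
  define d where "d = (INF v\<in>V. (norm (x - v))\<^sup>2)"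
  have ne: "V \<noteq> {}" using subspace_0[OF V] by auto
  have bdd: "bdd_below ((\<lambda>v. (norm (x - v))\<^sup>2) ` V)" by (rule bdd_belowI[of _ 0]) auto
  have d: "d \<le> (norm (x - v))\<^sup>2" if "v \<in> V" for v
    unfolding d_def using bdd that by (rule cINF_lower)
  have "\<exists>v\<in>V. (norm (x - v))\<^sup>2 < d + inverse (real (Suc n))" for n
    using cINF_less_iff[OF ne bdd, of "d + inverse (real (Suc n))"] unfolding d_def by simp
  then obtain f where f: "\<And>n. f n \<in> V" "\<And>n. (norm (x - f n))\<^sup>2 < d + inverse (real (Suc n))"
    by metis
  have lim: "(\<lambda>n. (norm (x - f n))\<^sup>2) \<longlonglongrightarrow> d"
  proof (rule tendsto_sandwich[of "\<lambda>_. d" _ _ "\<lambda>n. d + inverse (real (Suc n))"])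
    show "(\<lambda>n. d + inverse (real (Suc n))) \<longlonglongrightarrow> d"
      using tendsto_add[OF tendsto_const LIMSEQ_inverse_real_of_nat] by force
  next
    show "\<forall>\<^sub>F n in sequentially. (norm (x - f n))\<^sup>2 \<le> d + inverse (real (Suc n))"
      using f(2) less_imp_le by (intro always_eventually) blast
  qed (use d f(1) in auto)
  from minimizing_sequence_Cauchy[OF V f(1) d lim] obtain p where p: "f \<longlonglongrightarrow> p"
    using Cauchy_convergent_iff convergent_def by blast
  have pV: "p \<in> V" using closed_sequentially[OF cl f(1) p] .
  have "(\<lambda>n. (norm (x - f n))\<^sup>2) \<longlonglongrightarrow> (norm (x - p))\<^sup>2"
    by (intro tendsto_intros p)
  then have dp: "d = (norm (x - p))\<^sup>2" using lim LIMSEQ_unique by blast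
  have "ip H (x - p) v = 0" if v: "v \<in> V" for v
  proof (cases "v = 0")
    case False
    \<comment> \<open>Moving \<open>p\<close> by the component of \<open>x - p\<close> along
      \<open>v\<close> would bring it strictly closer to \<open>x\<close> unless the inner product
      vanishes.\<close>
    let ?c = "ip H (x - p) v / of_real ((norm v)\<^sup>2)"
    have "d \<le> (norm (x - (p + scal H ?c v)))\<^sup>2"
      by (intro d subspace_add[OF V] pV subspace_scale[OF V] v)
    also have "x - (p + scal H ?c v) = x - p - scal H ?c v" by simp
    finally have "(norm (ip H (x - p) v))\<^sup>2 / (norm v)\<^sup>2 \<le> 0"
      unfolding norm_diff_component_sq[OF False] dp by simp
    then show ?thesis using False by (simp add: divide_le_0_iff power2_eq_square mult_le_0_iff)
  qed simp
  with pV show ?thesis by (auto simp: orth_compl_def)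
qed

lemma orth_projI:
  assumes V: "subspace V" and "p \<in> V" "x - p \<in> orth_compl H V"
  shows "orth_proj H V x = p"
  unfolding orth_proj_def
proof (rule the_equality)
  fix q assume q: "q \<in> V \<and> x - q \<in> orth_compl H V"
  have "p - q \<in> V" using q assms subspace_diff by blast
  moreover have "(x - q) - (x - p) \<in> orth_compl H V"
    by (rule subspace_diff[OF subspace_orth_compl]) (use q assms in auto)
  ultimately show "q = p" using orth_compl_disjoint[of "p - q" V] by simp
qed (use assms in auto)

lemma
  assumes V: "subspace V" "closed V"
  shows orth_proj_in: "orth_proj H V x \<in> V"
    and orth_proj_diff: "x - orth_proj H V x \<in> orth_compl H V"
proof -
  obtain p where p: "p \<in> V" "x - p \<in> orth_compl H V"
    using projection_exists[OF V] by blast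
  then show "orth_proj H V x \<in> V" "x - orth_proj H V x \<in> orth_compl H V"
    using orth_projI[OF V(1) p] by simp_all
qed

lemma orth_proj_id: "subspace V \<Longrightarrow> x \<in> V \<Longrightarrow> orth_proj H V x = x"
  by (rule orth_projI) (auto simp: subspace_0[OF subspace_orth_compl])

lemma orth_proj_selfadj:
  assumes V: "subspace V" "closed V"
  shows "ip H (orth_proj H V x) y = ip H x (orth_proj H V y)"
proof -
  let ?P = "orth_proj H V"
  have "ip H (y - ?P y) (?P x) = 0" "ip H (x - ?P x) (?P y) = 0"
    using orth_proj_diff[OF V] orth_proj_in[OF V] by (auto simp: orth_compl_def)
  then have "ip H (?P x) (y - ?P y) = 0" "ip H (x - ?P x) (?P y) = 0"
    by (auto simp: ip_eq_0_commute)
  then show ?thesis by (simp add: ip_diff_left ip_diff_right)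
qed

lemma norm_orth_proj_sq:
  assumes V: "subspace V" "closed V"
  shows "(norm x)\<^sup>2 = (norm (orth_proj H V x))\<^sup>2 + (norm (x - orth_proj H V x))\<^sup>2"
proof -
  let ?P = "orth_proj H V"
  have "ip H (x - ?P x) (?P x) = 0"
    using orth_proj_diff[OF V] orth_proj_in[OF V] by (auto simp: orth_compl_def)
  from pythagoras[OF this] show ?thesis by simp
qed

lemma norm_orth_proj_le:
  assumes V: "subspace V" "closed V"
  shows "norm (orth_proj H V x) \<le> norm x"
proof (rule power2_le_imp_le)
  show "(norm (orth_proj H V x))\<^sup>2 \<le> (norm x)\<^sup>2"
    using norm_orth_proj_sq[OF assms, of x] zero_le_power2[of "norm (x - orth_proj H V x)"] by linarith
qed simp

lemma bounded_opsI:
  assumes "hilbert_space K" "\<And>x y. T (x + y) = T x + T y" "\<And>c x. T (scal H c x) = scal K c (T x)"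
    "\<And>x. norm (T x) \<le> norm x * c"
  shows "T \<in> bounded_ops H K"
proof -
  interpret K: hilbert_space K by fact
  have "T (t *\<^sub>R x) = t *\<^sub>R T x" for t x
    by (metis assms(3) scal_of_real K.scal_of_real)
  then have "bounded_linear T"
    using assms by (intro bounded_linear_intro[where K = c])
  moreover have "Vector_Spaces.linear (scal H) (scal K) T"
    using assms vector_space_axioms K.vector_space_axioms
    by (simp add: Vector_Spaces.linear_iff vector_space_pair_def)
  ultimately show ?thesis by (simp add: bounded_ops_def)
qed

text \<open>Linearity is read off from self-adjointness by testing against all vectors.\<close>

lemma orth_proj_add:
  assumes V: "subspace V" "closed V"
  shows "orth_proj H V (x + y) = orth_proj H V x + orth_proj H V y"
  by (rule eqI_ip) (simp add: orth_proj_selfadj[OF V] ip_add_left)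

lemma orth_proj_scal:
  assumes V: "subspace V" "closed V"
  shows "orth_proj H V (scal H c x) = scal H c (orth_proj H V x)"
  by (rule eqI_ip) (simp add: orth_proj_selfadj[OF V] ip_scal_left)

lemma orth_proj_bounded_ops:
  assumes V: "subspace V" "closed V"
  shows "orth_proj H V \<in> bounded_ops H H"
proof (rule bounded_opsI[where c = 1])
  show "hilbert_space H" by (rule hilbert_space_axioms)
qed (simp_all add: orth_proj_add[OF V] orth_proj_scal[OF V] norm_orth_proj_le[OF V])

end

section \<open>Orthonormal families\<close>

context hilbert_space
begin

text \<open>Zero members are allowed, so that finite families can be padded to infinite ones.\<close>

definition onf :: "'i set \<Rightarrow> ('i \<Rightarrow> 'a) \<Rightarrow> bool" where
  "onf I g \<longleftrightarrow> (\<forall>i\<in>I. \<forall>j\<in>I. ip H (g i) (g j) = (if i = j \<and> g i \<noteq> 0 then 1 else 0))"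

text \<open>The Fourier sum gives the projector onto the span of a finite family directly, without
  first showing that this span is closed, as the existence of values of \<open>orth_proj\<close>
  would demand.\<close>

definition onf_proj :: "'i set \<Rightarrow> ('i \<Rightarrow> 'a) \<Rightarrow> 'a \<Rightarrow> 'a" where
  "onf_proj I g x = (\<Sum>i\<in>I. scal H (ip H x (g i)) (g i))"

lemma onf_subset: "onf I g \<Longrightarrow> J \<subseteq> I \<Longrightarrow> onf J g"
  unfolding onf_def by blast

lemma onf_norm: "onf I g \<Longrightarrow> i \<in> I \<Longrightarrow> g i \<noteq> 0 \<Longrightarrow> norm (g i) = 1"
proof -
  assume "onf I g" "i \<in> I" "g i \<noteq> 0"
  then have "of_real ((norm (g i))\<^sup>2) = (of_real 1 :: 'k)"
    by (simp only: ip_self[symmetric]) (simp add: onf_def)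
  then have "(norm (g i))\<^sup>2 = 1" by (simp only: of_real_eq_iff)
  then show ?thesis by (simp add: power2_eq_1_iff) (use norm_ge_zero[of "g i"] in linarith)
qed

lemma onf_norm_le: "onf I g \<Longrightarrow> i \<in> I \<Longrightarrow> norm (g i) \<le> 1"
  using onf_norm[of I g i] by (cases "g i = 0") auto

context
  fixes I :: "'i set" and g :: "'i \<Rightarrow> 'a"
  assumes I: "finite I" and g: "onf I g"
begin

lemma ip_onf_proj: "j \<in> I \<Longrightarrow> ip H (onf_proj I g x) (g j) = ip H x (g j)"
proof -
  assume j: "j \<in> I"
  have "ip H (onf_proj I g x) (g j) = (\<Sum>i\<in>I. ip H x (g i) * ip H (g i) (g j))"
    by (simp add: onf_proj_def ip_sum_left ip_scal_left)
  also have "\<dots> = (\<Sum>i\<in>I. if i = j then ip H x (g j) else 0)"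
    using g j by (intro sum.cong) (auto simp: onf_def)
  finally show ?thesis using I j by simp
qed

lemma diff_onf_proj_orth: "x - onf_proj I g x \<in> orth_compl H (g ` I)"
  by (auto simp: orth_compl_def ip_diff_left ip_onf_proj)

lemma onf_proj_in_span: "onf_proj I g x \<in> span (g ` I)"
  unfolding onf_proj_def by (intro span_sum span_scale span_base) auto

lemma diff_onf_proj_orth_span: "y \<in> span (g ` I) \<Longrightarrow> ip H (x - onf_proj I g x) y = 0"
  using diff_onf_proj_orth[of x] orth_compl_span[of "g ` I"] by (auto simp: orth_compl_def)

lemma norm_onf_proj_sq: "(norm (onf_proj I g x))\<^sup>2 = (\<Sum>i\<in>I. (norm (ip H x (g i)))\<^sup>2)"
proof -
  have "of_real ((norm (onf_proj I g x))\<^sup>2)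
      = (\<Sum>i\<in>I. ip H x (g i) * ip H (g i) (onf_proj I g x))"
    unfolding ip_self[symmetric]
    by (subst (1) onf_proj_def) (simp add: ip_sum_left ip_scal_left)
  also have "\<dots> = (\<Sum>i\<in>I. ip H x (g i) * conj (ip H x (g i)))"
    by (intro sum.cong refl) (simp add: ip_commute[of "g _" "onf_proj I g x"] ip_onf_proj)
  also have "\<dots> = of_real (\<Sum>i\<in>I. (norm (ip H x (g i)))\<^sup>2)"
    by (simp add: mult_conj)
  finally show ?thesis by (simp only: of_real_eq_iff)
qed

lemma bessel_eq: "(norm x)\<^sup>2 = (\<Sum>i\<in>I. (norm (ip H x (g i)))\<^sup>2) + (norm (x - onf_proj I g x))\<^sup>2"
  using pythagoras[OF diff_onf_proj_orth_span[OF onf_proj_in_span], of x x]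
  by (simp add: norm_onf_proj_sq)

lemma bessel_le: "(\<Sum>i\<in>I. (norm (ip H x (g i)))\<^sup>2) \<le> (norm x)\<^sup>2"
  using bessel_eq[of x] zero_le_power2[of "norm (x - onf_proj I g x)"] by linarith

lemma onf_proj_best:
  assumes y: "y \<in> span (g ` I)"
  shows "(norm (x - onf_proj I g x))\<^sup>2 \<le> (norm (x - y))\<^sup>2"
proof -
  have "onf_proj I g x - y \<in> span (g ` I)" by (intro span_diff onf_proj_in_span y)
  from pythagoras[OF diff_onf_proj_orth_span[OF this], of x]
  have "(norm (x - y))\<^sup>2 = (norm (x - onf_proj I g x))\<^sup>2 + (norm (onf_proj I g x - y))\<^sup>2" by simp
  then show ?thesis using zero_le_power2[of "norm (onf_proj I g x - y)"] by linarith
qed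

lemma onf_proj_span: "y \<in> span (g ` I) \<Longrightarrow> onf_proj I g y = y"
  using onf_proj_best[of y y] by simp

lemma onf_proj_bounded_ops: "onf_proj I g \<in> bounded_ops H H"
proof (rule bounded_opsI[where c = 1])
  show "hilbert_space H" by (rule hilbert_space_axioms)
  show "onf_proj I g (x + y) = onf_proj I g x + onf_proj I g y" for x y
    by (simp add: onf_proj_def ip_add_left scale_left_distrib sum.distrib)
  show "onf_proj I g (scal H c x) = scal H c (onf_proj I g x)" for c x
    by (simp add: onf_proj_def ip_scal_left scale_sum_right)
  have le: "(norm (onf_proj I g x))\<^sup>2 \<le> (norm x)\<^sup>2" for x
    using bessel_le[of x] by (simp add: norm_onf_proj_sq)
  show "norm (onf_proj I g x) \<le> norm x * 1" for x
    using power2_le_imp_le[OF le norm_ge_zero, of x] by simp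
qed

end

lemma onf_independent:
  assumes g: "onf I g" and nz: "\<And>i. i \<in> I \<Longrightarrow> g i \<noteq> 0"
  shows "inj_on g I" "independent (g ` I)"
proof -
  show inj: "inj_on g I"
  proof (rule inj_onI)
    fix i j assume *: "i \<in> I" "j \<in> I" "g i = g j"
    then show "i = j" using g nz unfolding onf_def
      by (metis ip_self norm_eq_zero of_real_eq_0_iff power_eq_0_iff)
  qed
  have False if "a \<in> g ` I" "a \<in> span (g ` I - {a})" for a
  proof -
    have "a \<in> orth_compl H (g ` I - {a})"
      using that(1) g by (auto simp: orth_compl_def onf_def split: if_splits)
    then have "a \<in> orth_compl H (span (g ` I - {a}))" by (simp add: orth_compl_span)
    then have "a = 0" using orth_compl_disjoint that(2) by blast
    then show False using that(1) nz by auto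
  qed
  then show "independent (g ` I)" unfolding dependent_def by blast
qed

lemma onf_insert:
  assumes E: "onf E (\<lambda>e. e)" and u: "norm u = 1" "u \<in> orth_compl H E"
  shows "onf (insert u E) (\<lambda>e. e)"
proof -
  have "ip H u u = 1" using u by (simp add: ip_self)
  moreover have "u \<noteq> 0" using u by auto
  moreover have "ip H u e = 0 \<and> ip H e u = 0" if "e \<in> E" for e
    using u that ip_eq_0_commute by (auto simp: orth_compl_def)
  ultimately show ?thesis using E by (auto simp: onf_def)
qed

section \<open>Orthonormal bases, Parseval's identity and Gram--Schmidt\<close>

lemma normalize_orth_compl:
  "x \<in> orth_compl H E \<Longrightarrow> (1 / norm x) *\<^sub>R x \<in> orth_compl H E"
  by (auto simp: orth_compl_def ip_scaleR_left)

theorem onb_exists: "\<exists>E. is_onb H E"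
proof -
  \<comment> \<open>\<open>onf\<close> tolerates the zero vector while \<open>is_onb\<close> does
    not, hence the extra condition.\<close>
  define A where "A = {E. 0 \<notin> E \<and> onf E (\<lambda>e. e)}"
  have "\<exists>M\<in>A. \<forall>X\<in>A. M \<subseteq> X \<longrightarrow> X = M"
  proof (rule subset_Zorn_nonempty)
    show "A \<noteq> {}" by (auto simp: A_def onf_def intro: exI[of _ "{}"])
    fix C assume C: "C \<noteq> {}" "subset.chain A C"
    then have CA: "C \<subseteq> A" by (auto simp: subset.chain_def)
    have "onf (\<Union>C) (\<lambda>e. e)" unfolding onf_def
    proof (intro ballI)
      fix e f assume ef: "e \<in> \<Union>C" "f \<in> \<Union>C"
      then obtain X where X: "X \<in> C" "e \<in> X" "f \<in> X"
        using C(2) unfolding subset.chain_def by blast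
      then have "onf X (\<lambda>e. e)" using CA by (auto simp: A_def)
      then show "ip H e f = (if e = f \<and> e \<noteq> 0 then 1 else 0)" using X by (auto simp: onf_def)
    qed
    then show "\<Union>C \<in> A" using CA by (auto simp: A_def)
  qed
  then obtain E where E: "E \<in> A" and max: "\<And>X. X \<in> A \<Longrightarrow> E \<subseteq> X \<Longrightarrow> X = E" by blast
  have cl: "closed (closure (span E))" "subspace (closure (span E))"
    by (auto intro: subspace_closure)
  have "closure (span E) = UNIV"
  proof (rule ccontr)
    assume "closure (span E) \<noteq> UNIV"
    then obtain x where x: "x \<notin> closure (span E)" by auto
    obtain p where p: "p \<in> closure (span E)" "x - p \<in> orth_compl H (closure (span E))"
      using projection_exists[OF cl(2,1)] by blast
    define u where "u = (1 / norm (x - p)) *\<^sub>R (x - p)"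
    have "x - p \<noteq> 0" using x p(1) by auto
    then have u: "norm u = 1" by (simp add: u_def)
    have uE: "u \<in> orth_compl H E"
      using p(2) unfolding u_def orth_compl_closure orth_compl_span by (rule normalize_orth_compl)
    have "insert u E \<in> A" using onf_insert[OF _ u uE] E u by (auto simp: A_def)
    then have "u \<in> E" using max by blast
    then have "u = 0" using orth_compl_disjoint uE by blast
    then show False using u by simp
  qed
  then show ?thesis using E unfolding is_onb_def A_def onf_def by (intro exI[of _ E]) auto
qed

lemma some_onb: "is_onb H (some_onb H)"
  unfolding some_onb_def using onb_exists by (rule someI_ex)

lemma is_onb_onf: "is_onb H E \<Longrightarrow> onf E (\<lambda>e. e)"
  using ip_zero_left[of 0] unfolding is_onb_def onf_def by (metis zero_neq_one)

text \<open>Bessel gives one inequality. For the other, density provides a finite combination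
  \<open>y\<close> of basis vectors within \<open>sqrt e\<close> of \<open>x\<close>; the Fourier
  sum over the same finite set approximates \<open>x\<close> at least as well, so its coefficients
  miss at most \<open>e\<close> of the squared norm.\<close>

theorem parseval:
  assumes E: "is_onb H E"
  shows "((\<lambda>e. (norm (ip H x e))\<^sup>2) has_sum (norm x)\<^sup>2) E"
proof -
  let ?f = "\<lambda>e. (norm (ip H x e))\<^sup>2"
  have on: "onf F (\<lambda>e. e)" if "F \<subseteq> E" for F using is_onb_onf[OF E] that by (rule onf_subset)
  have le: "sum ?f F \<le> (norm x)\<^sup>2" if "finite F" "F \<subseteq> E" for F
    using bessel_le[OF that(1) on[OF that(2)]] .
  have summ: "?f summable_on E"
    using le by (intro nonneg_bdd_above_summable_on bdd_aboveI) auto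
  have "infsum ?f E = (norm x)\<^sup>2"
  proof (rule antisym)
    show "infsum ?f E \<le> (norm x)\<^sup>2" using le summ by (intro infsum_le_finite_sums) auto
    show "(norm x)\<^sup>2 \<le> infsum ?f E"
    proof (rule field_le_epsilon)
      fix e :: real assume e: "e > 0"
      have "x \<in> closure (span E)" using E by (simp add: is_onb_def)
      then obtain y where y: "y \<in> span E" "dist y x < sqrt e"
        using e unfolding closure_approachable by (metis real_sqrt_gt_zero)
      from y(1) obtain F r where F: "finite F" "F \<subseteq> E" "y = (\<Sum>a\<in>F. scal H (r a) a)"
        unfolding span_explicit by auto
      have yF: "y \<in> span ((\<lambda>e. e) ` F)"
        unfolding F(3) by (intro span_sum span_scale span_base) auto
      have "(norm x)\<^sup>2 \<le> sum ?f F + (norm (x - y))\<^sup>2"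
        using bessel_eq[OF F(1) on[OF F(2)], of x] onf_proj_best[OF F(1) on[OF F(2)] yF, of x]
        by linarith
      also have "(norm (x - y))\<^sup>2 \<le> (sqrt e)\<^sup>2"
        using y(2) by (intro power_mono) (auto simp: dist_norm norm_minus_commute)
      also have "(sqrt e)\<^sup>2 = e" using e by simp
      also have "sum ?f F \<le> infsum ?f E"
        using summ F by (intro finite_sum_le_infsum) auto
      finally show "(norm x)\<^sup>2 \<le> infsum ?f E + e" by simp
    qed
  qed
  with summ show ?thesis by (simp add: has_sum_iff)
qed

text \<open>A vector dependent on the earlier ones contributes no new direction, so only an
  inequality of cardinalities survives; in this form a rank bound passes to an orthonormal
  family.\<close>

lemma gram_schmidt:
  assumes "finite S"
  shows "\<exists>U. finite U \<and> card U \<le> card S \<and> onf U (\<lambda>e. e) \<and> S \<subseteq> span U"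
  using assms
proof induction
  case empty
  show ?case by (intro exI[of _ "{}"]) (auto simp: onf_def)
next
  case (insert a S)
  then obtain U where U: "finite U" "card U \<le> card S" "onf U (\<lambda>e. e)" "S \<subseteq> span U" by blast
  define b where "b = a - onf_proj U (\<lambda>e. e) a"
  have p: "onf_proj U (\<lambda>e. e) a \<in> span U" using onf_proj_in_span[OF U(1,3)] by simp
  show ?case
  proof (cases "b = 0")
    case True
    then have "a \<in> span U" using p by (simp add: b_def)
    then show ?thesis using U insert by (intro exI[of _ U]) auto
  next
    case False
    define u where "u = (1 / norm b) *\<^sub>R b"
    have u: "norm u = 1" using False by (simp add: u_def)
    have uO: "u \<in> orth_compl H U"
      unfolding u_def b_def using diff_onf_proj_orth[OF U(1,3)] by (intro normalize_orth_compl) simp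
    have "b = scal H (of_real (norm b)) u" using False by (simp add: u_def scal_of_real)
    then have "b \<in> span (insert u U)" by (metis span_base span_scale insertI1)
    moreover have sub: "span U \<subseteq> span (insert u U)" by (rule span_mono) auto
    ultimately have "b + onf_proj U (\<lambda>e. e) a \<in> span (insert u U)" using p by (blast intro: span_add)
    then have "a \<in> span (insert u U)" by (simp add: b_def)
    moreover have "card (insert u U) \<le> card (insert a S)"
      using U insert card_insert_le_m1 by (simp add: card_insert_if)
    ultimately show ?thesis using U sub onf_insert[OF U(3) u uO]
      by (intro exI[of _ "insert u U"]) auto
  qed
qed

lemma has_dim_subspace:
  assumes "subspace V" "V \<subseteq> span T" "finite T"
  shows "\<exists>n\<le>card T. has_dim H V n"
proof -
  obtain S where S: "S \<subseteq> V" "independent S" "V \<subseteq> span S" using maximal_independent_subset by blast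
  have "finite S \<and> card S \<le> card T"
    using S assms independent_span_bound[of T S] by auto
  moreover have "span S = V" using S assms by (simp add: span_subspace)
  ultimately show ?thesis using S unfolding has_dim_def by blast
qed

lemma has_dim_unique: "has_dim H V m \<Longrightarrow> has_dim H V n \<Longrightarrow> m = n"
  unfolding has_dim_def by (auto dest!: dim_span_eq_card_independent)

end

section \<open>Bounded operators and adjoints\<close>

lemma
  assumes "T \<in> bounded_ops H K"
  shows bounded_ops_add: "T (x + y) = T x + T y"
    and bounded_ops_scal: "T (scal H c x) = scal K c (T x)"
    and bounded_ops_bounded_linear: "bounded_linear T"
    and bounded_ops_diff: "T (x - y) = T x - T y"
    and bounded_ops_zero: "T 0 = 0"
proof -
  show T: "bounded_linear T" using assms by (simp add: bounded_ops_def)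
  show "T (x + y) = T x + T y" "T (scal H c x) = scal K c (T x)"
    using assms by (auto simp: bounded_ops_def Vector_Spaces.linear_iff)
  show "T (x - y) = T x - T y" "T 0 = 0"
    using T linear_diff linear_0 bounded_linear.linear by blast+
qed

lemma bounded_ops_comp:
  "T \<in> bounded_ops H K \<Longrightarrow> S \<in> bounded_ops K L \<Longrightarrow> S \<circ> T \<in> bounded_ops H L"
  using Vector_Spaces.linear_compose[of "scal H" "scal K" T "scal L" S]
  by (auto simp: bounded_ops_def o_def intro: bounded_linear_compose)

locale hilbert_pair = H: hilbert_space H + K: hilbert_space K
  for H :: "('k::real_or_complex, 'a::banach) hilbert" and K :: "('k, 'b::banach) hilbert"
begin

lemma bounded_ops_sub:
  assumes "T \<in> bounded_ops H K" "S \<in> bounded_ops H K"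
  shows "(\<lambda>x. T x - S x) \<in> bounded_ops H K"
proof -
  have "bounded_linear (\<lambda>x. T x - S x)"
    using assms by (intro bounded_linear_sub bounded_ops_bounded_linear)
  moreover have "Vector_Spaces.linear (scal H) (scal K) (\<lambda>x. T x - S x)"
    using assms H.vector_space_axioms K.vector_space_axioms
    by (auto simp: Vector_Spaces.linear_iff bounded_ops_add[OF assms(1)] bounded_ops_add[OF assms(2)]
        bounded_ops_scal[OF assms(1)] bounded_ops_scal[OF assms(2)] K.scale_right_diff_distrib)
  ultimately show ?thesis by (simp add: bounded_ops_def)
qed

lemma ker_subspace: "T \<in> bounded_ops H K \<Longrightarrow> H.subspace (ker T)"
  by (rule H.subspaceI) (auto simp: ker_def bounded_ops_add bounded_ops_scal bounded_ops_zero)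

lemma ker_closed: "T \<in> bounded_ops H K \<Longrightarrow> closed (ker T)"
  unfolding ker_def
  by (intro closed_Collect_eq continuous_on_const linear_continuous_on bounded_ops_bounded_linear)

lemma range_subspace: "T \<in> bounded_ops H K \<Longrightarrow> K.subspace (range T)"
  by (rule K.subspaceI)
     (auto simp: image_iff simp flip: bounded_ops_add bounded_ops_scal bounded_ops_zero)

text \<open>Riesz representation of the functional
  \<open>x \<mapsto> \<langle>T x, y\<rangle>\<close>, which gives the definite description in
  \<open>adj\<close> a value.\<close>

lemma riesz:
  assumes T: "T \<in> bounded_ops H K"
  shows "\<exists>z. \<forall>x. ip K (T x) y = ip H x z"
proof -
  define N where "N = {x. ip K (T x) y = 0}"
  have sub: "H.subspace N"
    using T by (intro H.subspaceI)
      (auto simp: N_def bounded_ops_add bounded_ops_scal bounded_ops_zero K.ip_add_left K.ip_scal_left)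
  have "bounded_linear (\<lambda>x. ip K (T x) y)"
    by (rule bounded_linear_compose[OF K.bounded_linear_ip_left bounded_ops_bounded_linear[OF T]])
  then have cl: "closed N" unfolding N_def
    by (intro closed_Collect_eq continuous_on_const linear_continuous_on)
  show ?thesis
  proof (cases "N = UNIV")
    case True
    then show ?thesis by (intro exI[of _ 0]) (auto simp: N_def)
  next
    case False
    then obtain w where w: "w \<notin> N" by auto
    obtain p where p: "p \<in> N" "w - p \<in> orth_compl H N" using H.projection_exists[OF sub cl] by blast
    define u where "u = w - p"
    define \<phi> where "\<phi> x = ip K (T x) y" for x
    have \<phi>u: "\<phi> u \<noteq> 0"
      using w p(1) by (simp add: \<phi>_def u_def N_def bounded_ops_diff[OF T] K.ip_diff_left)
    then have u0: "u \<noteq> 0" by (auto simp: \<phi>_def bounded_ops_zero[OF T])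
    \<comment> \<open>\<open>u\<close> is orthogonal to the hyperplane \<open>N\<close>, so the
      representing vector is a multiple of \<open>u\<close>. The coefficient is forced by the case
      \<open>x = u\<close> and is conjugated because \<open>ip\<close> is conjugate-linear on the
      right.\<close>
    have "\<phi> x = ip H x (scal H (conj (\<phi> u / ip H u u)) u)" for x
    proof -
      have "x - scal H (\<phi> x / \<phi> u) u \<in> N"
        using \<phi>u by (simp add: N_def \<phi>_def bounded_ops_diff[OF T] bounded_ops_scal[OF T]
            K.ip_diff_left K.ip_scal_left)
      then have "ip H u (x - scal H (\<phi> x / \<phi> u) u) = 0" using p(2) by (auto simp: orth_compl_def u_def)
      then have "ip H (x - scal H (\<phi> x / \<phi> u) u) u = 0" by (subst H.ip_eq_0_commute)
      then have "ip H x u = \<phi> x / \<phi> u * ip H u u"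
        by (simp add: H.ip_diff_left H.ip_scal_left)
      then show ?thesis using \<phi>u u0 by (simp add: H.ip_scal_right H.ip_self)
    qed
    then show ?thesis unfolding \<phi>_def by blast
  qed
qed

lemma adjI:
  assumes "\<And>x. ip K (T x) y = ip H x z"
  shows "adj H K T y = z"
  unfolding adj_def
proof (rule the_equality)
  fix z' assume "\<forall>x. ip K (T x) y = ip H x z'"
  then have "ip H x (z' - z) = 0" for x
    using assms by (simp add: H.ip_diff_right)
  then have "ip H (z' - z) x = 0" for x by (subst H.ip_eq_0_commute)
  then show "z' = z" using H.eq_zeroI[of "z' - z"] by simp
qed (use assms in simp)

lemma adj_ip: "T \<in> bounded_ops H K \<Longrightarrow> ip K (T x) y = ip H x (adj H K T y)"
  using riesz[of T y] adjI[of T y] by metis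

lemma adj_ip_left: "T \<in> bounded_ops H K \<Longrightarrow> ip H (adj H K T y) x = ip K y (T x)"
  using adj_ip[of T x y] H.ip_commute[of "adj H K T y" x] K.ip_commute[of y "T x"] by simp

text \<open>Pairing \<open>T (adj H K T y)\<close> with \<open>y\<close> gives the squared norm of
  \<open>adj H K T y\<close>; Cauchy--Schwarz and cancellation do the rest. The bound is stated for
  squares because \<open>s\<close> later is the square of an operator norm.\<close>

lemma adj_norm_sq_le:
  assumes T: "T \<in> bounded_ops H K" and s0: "0 \<le> s" and s: "\<And>x. (norm (T x))\<^sup>2 \<le> s * (norm x)\<^sup>2"
  shows "(norm (adj H K T y))\<^sup>2 \<le> s * (norm y)\<^sup>2"
proof (cases "adj H K T y = 0")
  case True
  have "0 \<le> s * (norm y)\<^sup>2" using s0 by simp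
  then show ?thesis using True by simp
next
  case False
  let ?a = "norm (adj H K T y)"
  have "of_real (?a\<^sup>2) = ip K (T (adj H K T y)) y"
    by (simp add: adj_ip[OF T] H.ip_self)
  then have "?a\<^sup>2 = norm (ip K (T (adj H K T y)) y)" by (metis norm_of_real abs_power2)
  also have "\<dots> \<le> norm (T (adj H K T y)) * norm y" by (rule K.cauchy_schwarz)
  finally have "(?a\<^sup>2)\<^sup>2 \<le> (norm (T (adj H K T y)) * norm y)\<^sup>2" by (rule power_mono) simp
  also have "\<dots> \<le> (s * ?a\<^sup>2) * (norm y)\<^sup>2"
    unfolding power_mult_distrib by (intro mult_right_mono s) simp
  finally have "?a\<^sup>2 * ?a\<^sup>2 \<le> ?a\<^sup>2 * (s * (norm y)\<^sup>2)" by (simp add: power2_eq_square mult.commute mult.left_commute)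
  moreover have "?a\<^sup>2 > 0" using False by simp
  ultimately show ?thesis by (rule mult_left_le_imp_le)
qed


lemma bounded_ops_norm_sq_le:
  assumes "T \<in> bounded_ops H K"
  obtains s where "0 \<le> s" "\<And>x. (norm (T x))\<^sup>2 \<le> s * (norm x)\<^sup>2"
proof -
  obtain c where c: "\<And>x. norm (T x) \<le> norm x * c" "c > 0"
    using bounded_linear.pos_bounded[OF bounded_ops_bounded_linear[OF assms]] by blast
  have "(norm (T x))\<^sup>2 \<le> c\<^sup>2 * (norm x)\<^sup>2" for x
    using power_mono[OF c(1)[of x], of 2] by (simp add: power_mult_distrib mult.commute)
  then show thesis using that[of "c\<^sup>2"] by simp
qed

lemma adj_bounded_ops:
  assumes T: "T \<in> bounded_ops H K"
  shows "adj H K T \<in> bounded_ops K H"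
proof -
  obtain s where s: "0 \<le> s" "\<And>x. (norm (T x))\<^sup>2 \<le> s * (norm x)\<^sup>2"
    using bounded_ops_norm_sq_le[OF T] by blast
  show ?thesis
  proof (rule K.bounded_opsI[where c = "sqrt s"])
    show "hilbert_space H" by (rule H.hilbert_space_axioms)
    show "adj H K T (x + y) = adj H K T x + adj H K T y" for x y
      by (rule adjI) (simp add: adj_ip[OF T] H.ip_add_right K.ip_add_right)
    show "adj H K T (scal K c x) = scal H c (adj H K T x)" for c x
      by (rule adjI) (simp add: adj_ip[OF T] H.ip_scal_right K.ip_scal_right)
    show "norm (adj H K T y) \<le> norm y * sqrt s" for y
    proof (rule power2_le_imp_le)
      show "(norm (adj H K T y))\<^sup>2 \<le> (norm y * sqrt s)\<^sup>2"
        using adj_norm_sq_le[OF T s, of y] s(1) by (simp add: power_mult_distrib mult.commute)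
    qed (use s(1) in simp)
  qed
qed

end

lemma adj_adj:
  assumes "hilbert_pair H K" and T: "T \<in> bounded_ops H K"
  shows "adj K H (adj H K T) = T"
proof
  fix x
  interpret hilbert_pair H K by fact
  interpret KH: hilbert_pair K H ..
  show "adj K H (adj H K T) x = T x" by (rule KH.adjI) (simp add: adj_ip_left[OF T])
qed

section \<open>Hilbert--Schmidt operators\<close>

lemma has_sum_sum:
  fixes f :: "'i \<Rightarrow> 'j \<Rightarrow> real"
  assumes "finite I" "\<And>i. i \<in> I \<Longrightarrow> (f i has_sum s i) A"
  shows "((\<lambda>x. \<Sum>i\<in>I. f i x) has_sum (\<Sum>i\<in>I. s i)) A"
  using assms by (induction I) (auto intro!: has_sum_add)

lemma has_sum_diff:
  fixes f g :: "'j \<Rightarrow> real"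
  assumes "(f has_sum s) A" "(g has_sum t) A"
  shows "((\<lambda>x. f x - g x) has_sum s - t) A"
  using has_sum_add[OF assms(1), of "\<lambda>x. - g x" "- t"] assms(2) by (simp add: has_sum_uminus)

lemma hs_ops_bounded: "T \<in> hs_ops H K \<Longrightarrow> T \<in> bounded_ops H K"
  by (simp add: hs_ops_def)

lemma hs_norm_sq: "(hs_norm H T)\<^sup>2 = (\<Sum>\<^sub>\<infinity>e\<in>some_onb H. (norm (T e))\<^sup>2)"
  by (simp add: hs_norm_def infsum_nonneg)

lemma hs_norm_has_sum:
  "T \<in> hs_ops H K \<Longrightarrow> ((\<lambda>e. (norm (T e))\<^sup>2) has_sum (hs_norm H T)\<^sup>2) (some_onb H)"
  by (simp add: hs_ops_def hs_norm_sq)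

lemma hs_normI:
  assumes "T \<in> bounded_ops H K" "((\<lambda>e. (norm (T e))\<^sup>2) has_sum s) (some_onb H)"
  shows "T \<in> hs_ops H K \<and> (hs_norm H T)\<^sup>2 = s"
  using assms by (auto simp: hs_ops_def hs_norm_sq has_sum_iff)

lemma hs_norm_nonneg: "0 \<le> hs_norm H T"
  by (simp add: hs_norm_def infsum_nonneg)

context hilbert_pair
begin

lemma adj_parseval:
  assumes T: "T \<in> bounded_ops H K" and E: "is_onb H E"
  shows "((\<lambda>e. (norm (ip K (T e) y))\<^sup>2) has_sum (norm (adj H K T y))\<^sup>2) E"
  using H.parseval[OF E, of "adj H K T y"]
  by (simp add: adj_ip[OF T] H.norm_ip_commute[of _ "adj H K T y"])

text \<open>Exchanging a finite sum with the basis sum reduces the claim to Bessel's inequality for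
  each \<open>T e\<close>. Letting \<open>F\<close> grow afterwards takes the place of a double
  infinite sum.\<close>

lemma adj_finite_sum_le:
  assumes T: "T \<in> hs_ops H K" and F: "K.onf F (\<lambda>f. f)" "finite F"
  shows "(\<Sum>f\<in>F. (norm (adj H K T f))\<^sup>2) \<le> (hs_norm H T)\<^sup>2"
proof (rule has_sum_mono)
  note Tb = hs_ops_bounded[OF T]
  show "((\<lambda>e. \<Sum>f\<in>F. (norm (ip K (T e) f))\<^sup>2) has_sum (\<Sum>f\<in>F. (norm (adj H K T f))\<^sup>2)) (some_onb H)"
    by (intro has_sum_sum F adj_parseval Tb H.some_onb)
  show "((\<lambda>e. (norm (T e))\<^sup>2) has_sum (hs_norm H T)\<^sup>2) (some_onb H)"
    by (rule hs_norm_has_sum[OF T])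
  show "(\<Sum>f\<in>F. (norm (ip K (T e) f))\<^sup>2) \<le> (norm (T e))\<^sup>2" for e
    by (rule K.bessel_le[OF F(2,1)])
qed

lemma adj_hs_ops_le:
  assumes T: "T \<in> hs_ops H K"
  shows "adj H K T \<in> hs_ops K H \<and> (hs_norm K (adj H K T))\<^sup>2 \<le> (hs_norm H T)\<^sup>2"
proof -
  have le: "(\<Sum>f\<in>F. (norm (adj H K T f))\<^sup>2) \<le> (hs_norm H T)\<^sup>2" if "finite F" "F \<subseteq> some_onb K" for F
    using that K.onf_subset[OF K.is_onb_onf[OF K.some_onb]] by (intro adj_finite_sum_le T) auto
  then have "(\<lambda>f. (norm (adj H K T f))\<^sup>2) summable_on some_onb K"
    by (intro nonneg_bdd_above_summable_on bdd_aboveI[of _ "(hs_norm H T)\<^sup>2"]) auto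
  then show ?thesis using le T
    by (auto simp: hs_ops_def adj_bounded_ops hs_norm_sq[of K] intro!: infsum_le_finite_sums)
qed

theorem adj_hs:
  assumes T: "T \<in> hs_ops H K"
  shows "adj H K T \<in> hs_ops K H" "hs_norm K (adj H K T) = hs_norm H T"
proof -
  interpret KH: hilbert_pair K H ..
  show A: "adj H K T \<in> hs_ops K H" using adj_hs_ops_le[OF T] by simp
  have "adj K H (adj H K T) = T"
    by (rule adj_adj[OF hilbert_pair_axioms hs_ops_bounded[OF T]])
  then have "(hs_norm H T)\<^sup>2 \<le> (hs_norm K (adj H K T))\<^sup>2" using KH.adj_hs_ops_le[OF A] by simp
  then show "hs_norm K (adj H K T) = hs_norm H T"
    using adj_hs_ops_le[OF T] hs_norm_nonneg by (metis power2_eq_imp_eq order_antisym)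
qed

lemma hs_ops_sub:
  assumes T: "T \<in> hs_ops H K" and S: "S \<in> hs_ops H K"
  shows "(\<lambda>x. T x - S x) \<in> hs_ops H K"
proof -
  have le: "(norm (T e - S e))\<^sup>2 \<le> 2 * (norm (T e))\<^sup>2 + 2 * (norm (S e))\<^sup>2" for e
    using K.parallelogram[of "T e" "S e"] zero_le_power2[of "norm (T e + S e)"] by linarith
  have "(\<lambda>e. 2 * (norm (T e))\<^sup>2 + 2 * (norm (S e))\<^sup>2) summable_on some_onb H"
    using T S by (intro summable_on_add summable_on_cmult_right) (auto simp: hs_ops_def)
  then have "(\<lambda>e. (norm (T e - S e))\<^sup>2) summable_on some_onb H"
    by (rule summable_on_comparison_test) (simp_all add: le)
  then show ?thesis using T S bounded_ops_sub by (auto simp: hs_ops_def)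
qed

text \<open>Bessel's identity at each \<open>T e\<close>, summed over the basis. It expresses the
  error of projecting the values of \<open>T\<close> through the adjoint, whose squared norms on
  orthonormal families are what Ky Fan's inequality bounds.\<close>

lemma hs_pythagoras_onf:
  assumes T: "T \<in> hs_ops H K" and F: "finite I" "K.onf I g"
  shows "(hs_norm H T)\<^sup>2
    = (\<Sum>i\<in>I. (norm (adj H K T (g i)))\<^sup>2) + (hs_norm H (\<lambda>x. T x - K.onf_proj I g (T x)))\<^sup>2"
    and "(\<lambda>x. T x - K.onf_proj I g (T x)) \<in> hs_ops H K"
proof -
  note Tb = hs_ops_bounded[OF T]
  have eq: "(norm (T e - K.onf_proj I g (T e)))\<^sup>2
      = (norm (T e))\<^sup>2 - (\<Sum>i\<in>I. (norm (ip K (T e) (g i)))\<^sup>2)" for e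
    using K.bessel_eq[OF F, of "T e"] by simp
  have "((\<lambda>e. (norm (T e))\<^sup>2 - (\<Sum>i\<in>I. (norm (ip K (T e) (g i)))\<^sup>2)) has_sum
      (hs_norm H T)\<^sup>2 - (\<Sum>i\<in>I. (norm (adj H K T (g i)))\<^sup>2)) (some_onb H)"
    by (intro has_sum_diff hs_norm_has_sum[OF T] has_sum_sum F adj_parseval Tb H.some_onb)
  then have *: "((\<lambda>e. (norm (T e - K.onf_proj I g (T e)))\<^sup>2) has_sum
      (hs_norm H T)\<^sup>2 - (\<Sum>i\<in>I. (norm (adj H K T (g i)))\<^sup>2)) (some_onb H)"
    by (simp add: eq)
  have "(\<lambda>x. T x - K.onf_proj I g (T x)) \<in> bounded_ops H K"
    using bounded_ops_comp[OF Tb K.onf_proj_bounded_ops[OF F]]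
    by (intro bounded_ops_sub Tb) (simp add: o_def)
  from hs_normI[OF this *]
  show "(hs_norm H T)\<^sup>2
    = (\<Sum>i\<in>I. (norm (adj H K T (g i)))\<^sup>2) + (hs_norm H (\<lambda>x. T x - K.onf_proj I g (T x)))\<^sup>2"
    "(\<lambda>x. T x - K.onf_proj I g (T x)) \<in> hs_ops H K" by auto
qed

lemma hs_pythagoras_left:
  assumes T: "T \<in> hs_ops H K" and V: "K.subspace V" "closed V"
  shows "orth_proj K V \<circ> T \<in> hs_ops H K"
    and "(\<lambda>x. T x - orth_proj K V (T x)) \<in> hs_ops H K"
    and "(hs_norm H T)\<^sup>2 = (hs_norm H (orth_proj K V \<circ> T))\<^sup>2
           + (hs_norm H (\<lambda>x. T x - orth_proj K V (T x)))\<^sup>2"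
proof -
  have bd: "orth_proj K V \<circ> T \<in> bounded_ops H K"
    using bounded_ops_comp[OF hs_ops_bounded[OF T] K.orth_proj_bounded_ops[OF V]] .
  have "(\<lambda>e. (norm ((orth_proj K V \<circ> T) e))\<^sup>2) summable_on some_onb H"
  proof (rule summable_on_comparison_test)
    show "(\<lambda>e. (norm (T e))\<^sup>2) summable_on some_onb H" using T by (simp add: hs_ops_def)
    show "(norm ((orth_proj K V \<circ> T) e))\<^sup>2 \<le> (norm (T e))\<^sup>2" for e
      using K.norm_orth_proj_le[OF V, of "T e"] by (simp add: power_mono)
  qed simp
  with bd show 1: "orth_proj K V \<circ> T \<in> hs_ops H K" by (simp add: hs_ops_def)
  show 2: "(\<lambda>x. T x - orth_proj K V (T x)) \<in> hs_ops H K"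
    using hs_ops_sub[OF T 1] by (simp add: o_def)
  have "((\<lambda>e. (norm (T e))\<^sup>2) has_sum (hs_norm H (orth_proj K V \<circ> T))\<^sup>2
           + (hs_norm H (\<lambda>x. T x - orth_proj K V (T x)))\<^sup>2) (some_onb H)"
    using has_sum_add[OF hs_norm_has_sum[OF 1] hs_norm_has_sum[OF 2]]
    by (simp flip: K.norm_orth_proj_sq[OF V])
  then show "(hs_norm H T)\<^sup>2 = (hs_norm H (orth_proj K V \<circ> T))\<^sup>2
           + (hs_norm H (\<lambda>x. T x - orth_proj K V (T x)))\<^sup>2"
    using hs_norm_has_sum[OF T] has_sum_unique by blast
qed

lemma hs_pythagoras_right:
  assumes T: "T \<in> hs_ops H K" and V: "H.subspace V" "closed V"
  shows "T \<circ> orth_proj H V \<in> hs_ops H K"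
    and "(hs_norm H T)\<^sup>2 = (hs_norm H (T \<circ> orth_proj H V))\<^sup>2
           + (hs_norm H (\<lambda>x. T x - T (orth_proj H V x)))\<^sup>2"
proof -
  interpret KH: hilbert_pair K H ..
  note Tb = hs_ops_bounded[OF T]
  note A = adj_hs(1)[OF T]
  have 1: "adj K H (orth_proj H V \<circ> adj H K T) = T \<circ> orth_proj H V"
    by (intro ext KH.adjI) (simp add: H.orth_proj_selfadj[OF V] adj_ip_left[OF Tb])
  have 2: "adj K H (\<lambda>y. adj H K T y - orth_proj H V (adj H K T y)) = (\<lambda>x. T x - T (orth_proj H V x))"
    by (intro ext KH.adjI)
      (simp add: H.orth_proj_selfadj[OF V] adj_ip_left[OF Tb] H.ip_diff_left K.ip_diff_right)
  show "T \<circ> orth_proj H V \<in> hs_ops H K"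
    using KH.adj_hs(1)[OF KH.hs_pythagoras_left(1)[OF A V]] by (simp add: 1)
  show "(hs_norm H T)\<^sup>2 = (hs_norm H (T \<circ> orth_proj H V))\<^sup>2
           + (hs_norm H (\<lambda>x. T x - T (orth_proj H V x)))\<^sup>2"
    using KH.hs_pythagoras_left(3)[OF A V] KH.adj_hs(2)[OF KH.hs_pythagoras_left(1)[OF A V]]
      KH.adj_hs(2)[OF KH.hs_pythagoras_left(2)[OF A V]] adj_hs(2)[OF T] by (simp add: 1 2)
qed

section \<open>Operators of finite rank, and the operator norm bound\<close>

lemma rank_le_spanD:
  assumes "T \<in> rank_le_ops H K r"
  obtains F where "finite F" "card F \<le> r" "K.onf F (\<lambda>f. f)" "range T \<subseteq> K.span F"
proof -
  obtain S where S: "finite S" "card S \<le> r" "K.span S = range T"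
    using assms by (auto simp: rank_le_ops_def has_dim_def)
  obtain F where F: "finite F" "card F \<le> card S" "K.onf F (\<lambda>f. f)" "S \<subseteq> K.span F"
    using K.gram_schmidt[OF S(1)] by blast
  have "range T \<subseteq> K.span F" using S(3) F(4) K.span_minimal by blast
  then show thesis using that F S by auto
qed

lemma rank_le_opsI:
  assumes T: "T \<in> bounded_ops H K" and "range T \<subseteq> K.span S" "finite S" "card S \<le> r"
  shows "T \<in> rank_le_ops H K r"
  using K.has_dim_subspace[OF range_subspace[OF T] assms(2,3)] assms unfolding rank_le_ops_def
  by (auto intro: order_trans)

text \<open>Relative to an orthonormal \<open>F\<close> whose span contains the range,
  \<open>(norm (T e))\<^sup>2\<close> is a finite sum of squared coefficients, each summable over
  the basis by Parseval for the adjoint.\<close>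

lemma rank_le_hs_ops:
  assumes T: "T \<in> rank_le_ops H K r"
  shows "T \<in> hs_ops H K"
proof -
  have Tb: "T \<in> bounded_ops H K" using T by (simp add: rank_le_ops_def)
  obtain F where "finite F" "card F \<le> r" "K.onf F (\<lambda>f. f)" "range T \<subseteq> K.span F"
    by (rule rank_le_spanD[OF T])
  note F = this(1,3,4)
  have "(norm (T e))\<^sup>2 = (\<Sum>f\<in>F. (norm (ip K (T e) f))\<^sup>2)" for e
  proof -
    have "K.onf_proj F (\<lambda>f. f) (T e) = T e" using F by (intro K.onf_proj_span) auto
    then show ?thesis using K.norm_onf_proj_sq[OF F(1,2), of "T e"] by simp
  qed
  then have "((\<lambda>e. (norm (T e))\<^sup>2) has_sum (\<Sum>f\<in>F. (norm (adj H K T f))\<^sup>2)) (some_onb H)"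
    using F(1) by (simp add: has_sum_sum adj_parseval[OF Tb H.some_onb])
  from hs_normI[OF Tb this] show ?thesis by simp
qed

end

text \<open>The basis behind \<open>hs_norm\<close> is fixed and may not contain the direction of
  \<open>x\<close>. After passing to the adjoint any finite orthonormal family is admissible, in
  particular a single unit vector.\<close>

lemma (in hilbert_pair) norm_le_hs_norm:
  assumes T: "T \<in> hs_ops H K"
  shows "(norm (T x))\<^sup>2 \<le> (hs_norm H T)\<^sup>2 * (norm x)\<^sup>2"
proof (cases "x = 0")
  case False
  interpret KH: hilbert_pair K H ..
  note Tb = hs_ops_bounded[OF T]
  define u where "u = (1 / norm x) *\<^sub>R x"
  have u: "norm u = 1" and x: "x = norm x *\<^sub>R u" using False by (auto simp: u_def)
  have "H.onf (insert u {}) (\<lambda>f. f)"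
    by (rule H.onf_insert) (use u in \<open>auto simp: H.onf_def orth_compl_def\<close>)
  from KH.adj_finite_sum_le[OF adj_hs(1)[OF T] this]
  have le: "(norm (T u))\<^sup>2 \<le> (hs_norm H T)\<^sup>2"
    by (simp add: adj_adj[OF hilbert_pair_axioms Tb] adj_hs(2)[OF T])
  have "T x = norm x *\<^sub>R T u"
    using x bounded_linear.linear[OF bounded_ops_bounded_linear[OF Tb]] by (metis linear_scale)
  then have "(norm (T x))\<^sup>2 = (norm (T u))\<^sup>2 * (norm x)\<^sup>2" by (simp add: power_mult_distrib)
  then show ?thesis using mult_right_mono[OF le, of "(norm x)\<^sup>2"] by simp
qed (simp add: bounded_ops_zero[OF hs_ops_bounded[OF T]])

section \<open>The largest eigenvalue by power iteration\<close>

text \<open>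
  With \<open>s\<close> the square of the operator norm of \<open>L\<close>, the powers of \<open>T = L\<^sup>* L / s\<close> decrease,
  hence converge strongly to the projection onto the fixed space of \<open>T\<close>.  The fixed space is
  nonzero: otherwise the Hilbert--Schmidt norms of \<open>L T\<^sup>n\<close> would tend to \<open>0\<close> by dominated
  convergence, while their operator norms equal that of \<open>L\<close>.
\<close>

locale power_iteration = hilbert_pair H K
  for H :: "('k::real_or_complex, 'a::banach) hilbert" and K :: "('k, 'b::banach) hilbert" +
  fixes L :: "'a \<Rightarrow> 'b" and s :: real
  assumes L: "L \<in> hs_ops H K" and s: "0 < s"
    and bound: "\<And>x. (norm (L x))\<^sup>2 \<le> s * (norm x)\<^sup>2"
    and sharp: "\<And>c. c < s \<Longrightarrow> \<exists>x. c * (norm x)\<^sup>2 < (norm (L x))\<^sup>2"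
begin

definition T :: "'a \<Rightarrow> 'a" where
  "T x = (1 / s) *\<^sub>R adj H K L (L x)"

text \<open>The value of \<open>\<langle>T\<^sup>n x, x\<rangle>\<close>, in a form that is evidently real and nonnegative.\<close>

definition a :: "nat \<Rightarrow> 'a \<Rightarrow> real" where
  "a n x = (let y = (T ^^ (n div 2)) x in if even n then (norm y)\<^sup>2 else (norm (L y))\<^sup>2 / s)"

lemma Lb: "L \<in> bounded_ops H K"
  by (rule hs_ops_bounded[OF L])

lemma a_nonneg: "0 \<le> a n x"
  using s by (simp add: a_def Let_def)

lemma T_ip: "ip H (T x) y = (1 / s) *\<^sub>R ip K (L x) (L y)"
  by (simp add: T_def H.ip_scaleR_left adj_ip_left[OF Lb])

lemma T_selfadj: "ip H (T x) y = ip H x (T y)"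
  by (simp add: T_ip) (simp add: T_def H.ip_scaleR_right adj_ip[OF Lb])

lemma T_bounded_linear: "bounded_linear T"
  unfolding T_def using bounded_ops_bounded_linear[OF Lb]
    bounded_ops_bounded_linear[OF adj_bounded_ops[OF Lb]]
  by (intro bounded_linear_const_scaleR bounded_linear_compose[of "adj H K L" L])

lemma T_bounded_ops: "T \<in> bounded_ops H H"
  using T_bounded_linear H.vector_space_axioms
  by (auto simp: bounded_ops_def Vector_Spaces.linear_iff T_def bounded_ops_add[OF Lb]
      bounded_ops_scal[OF Lb] bounded_ops_add[OF adj_bounded_ops[OF Lb]]
      bounded_ops_scal[OF adj_bounded_ops[OF Lb]] H.scal_scaleR scaleR_right_distrib)

lemma T_pow_bounded_ops: "T ^^ n \<in> bounded_ops H H"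
proof (induction n)
  case 0
  have "(\<lambda>x. x) \<in> bounded_ops H H"
    by (rule H.bounded_opsI[where c = 1]) (use H.hilbert_space_axioms in auto)
  then show ?case by (simp add: id_def)
next
  case (Suc n)
  show ?case using bounded_ops_comp[OF Suc T_bounded_ops] by (simp only: funpow.simps)
qed

lemma T_pow_shift: "ip H ((T ^^ (i + k)) x) ((T ^^ j) y) = ip H ((T ^^ i) x) ((T ^^ (j + k)) y)"
proof (induction k arbitrary: j)
  case (Suc k)
  show ?case using Suc[of "Suc j"] by (simp add: T_selfadj)
qed simp

lemma ip_T_pow: "ip H ((T ^^ n) x) ((T ^^ m) x) = of_real (a (n + m) x)"
proof -
  let ?N = "n + m"
  let ?h = "?N div 2"
  have "ip H ((T ^^ n) x) ((T ^^ m) x) = ip H ((T ^^ ?N) x) x"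
    using T_pow_shift[of n m x 0 x] by simp
  \<comment> \<open>Splitting the powers evenly makes both arguments equal; an odd factor left over
    is turned into \<open>norm (L y)\<close> by \<open>T_ip\<close>.\<close>
  also have "\<dots> = ip H ((T ^^ (?N - ?h)) x) ((T ^^ ?h) x)"
    using T_pow_shift[of "?N - ?h" ?h x 0 x] by simp
  also have "\<dots> = of_real (a ?N x)"
  proof (cases "even ?N")
    case True
    then have "?N - ?h = ?h" by presburger
    with True show ?thesis by (simp add: a_def Let_def H.ip_self)
  next
    case False
    then have "?N - ?h = Suc ?h" by presburger
    then show ?thesis using False
      by (simp add: a_def Let_def T_ip K.ip_self scaleR_conv_of_real)
  qed
  finally show ?thesis .
qed

lemma a_Suc_le: "a (Suc n) x \<le> a n x"
proof (cases "even n")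
  case True
  define y where "y = (T ^^ (n div 2)) x"
  have "a (Suc n) x = (norm (L y))\<^sup>2 / s" "a n x = (norm y)\<^sup>2"
    using True by (auto simp: a_def Let_def y_def)
  then show ?thesis using bound[of y] s by (simp add: pos_divide_le_eq mult.commute)
next
  case False
  define y where "y = (T ^^ (n div 2)) x"
  have "Suc n div 2 = Suc (n div 2)" using False by presburger
  then have *: "a (Suc n) x = (norm (T y))\<^sup>2" "a n x = (norm (L y))\<^sup>2 / s"
    using False by (auto simp: a_def Let_def y_def)
  have "(norm (T y))\<^sup>2 = (norm (adj H K L (L y)))\<^sup>2 / s\<^sup>2"
    using s by (simp add: T_def power_divide)
  also have "\<dots> \<le> s * (norm (L y))\<^sup>2 / s\<^sup>2"
    using adj_norm_sq_le[OF Lb _ bound, of "L y"] s by (intro divide_right_mono) auto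
  also have "\<dots> = (norm (L y))\<^sup>2 / s" using s by (simp add: power2_eq_square)
  finally show ?thesis by (simp add: *)
qed

lemma a_decseq: "decseq (\<lambda>n. a n x)"
  by (intro decseq_SucI a_Suc_le)

text \<open>The second difference of the sequence at \<open>x\<close> is its value at
  \<open>x - T x\<close>, which is nonnegative.\<close>

lemma a_convex: "a (Suc n) x - a (Suc (Suc n)) x \<le> a n x - a (Suc n) x"
proof -
  have T1: "(T ^^ n) (T x) = (T ^^ Suc n) x" by (simp add: funpow_swap1)
  have "of_real (a n (x - T x)) = ip H ((T ^^ n) (x - T x)) (x - T x)"
    using ip_T_pow[of n "x - T x" 0] by simp
  also have "(T ^^ n) (x - T x) = (T ^^ n) x - (T ^^ Suc n) x"
    by (simp only: bounded_ops_diff[OF T_pow_bounded_ops] T1)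
  also have "ip H ((T ^^ n) x - (T ^^ Suc n) x) (x - T x)
     = of_real (a n x - 2 * a (Suc n) x + a (Suc (Suc n)) x)"
    using ip_T_pow[of n x 0] ip_T_pow[of n x 1] ip_T_pow[of "Suc n" x 0] ip_T_pow[of "Suc n" x 1]
    by (simp add: H.ip_diff_left H.ip_diff_right)
  finally have "a n (x - T x) = a n x - 2 * a (Suc n) x + a (Suc (Suc n)) x"
    by (simp only: of_real_eq_iff)
  then show ?thesis using a_nonneg[of n "x - T x"] by linarith
qed

text \<open>By convexity no later drop exceeds the first one, so a vector that loses little in one
  step loses at most \<open>n\<close> times as much in \<open>n\<close> steps. In
  \<open>fixed_point\<close> this contradicts the decay of the powers.\<close>

lemma a_lower: "a 0 x - real n * (a 0 x - a 1 x) \<le> a n x"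
proof -
  have d: "a n x - a (Suc n) x \<le> a 0 x - a 1 x" for n
  proof (induction n)
    case (Suc n)
    show ?case by (rule order_trans[OF a_convex Suc])
  qed simp
  show ?thesis
  proof (induction n)
    case (Suc n)
    then show ?case using d[of n] by (simp add: algebra_simps)
  qed simp
qed

text \<open>The squared distance of the \<open>m\<close>-th and \<open>n\<close>-th iterates is
  \<open>a (m + m) x + a (n + n) x - 2 * a (m + n) x\<close>, and the decreasing nonnegative
  sequence \<open>a\<close> has a limit at which these terms cancel.\<close>

lemma T_pow_convergent: "\<exists>y. (\<lambda>n. (T ^^ n) x) \<longlonglongrightarrow> y"
proof -
  obtain l where l: "(\<lambda>n. a n x) \<longlonglongrightarrow> l" and "\<forall>n. l \<le> a n x"
    by (rule decseq_convergent[OF a_decseq]) (use a_nonneg in blast)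
  then have lower: "l \<le> a n x" for n by blast
  have "Cauchy (\<lambda>n. (T ^^ n) x)"
  proof (rule metric_CauchyI)
    fix e :: real assume e: "e > 0"
    have "eventually (\<lambda>n. a n x < l + e\<^sup>2 / 2) sequentially"
      using order_tendstoD(2)[OF l, of "l + e\<^sup>2 / 2"] e by simp
    then obtain N where N: "\<And>n. n \<ge> N \<Longrightarrow> a n x < l + e\<^sup>2 / 2"
      by (auto simp: eventually_sequentially)
    have "norm ((T ^^ m) x - (T ^^ n) x) < e" if "m \<ge> N" "n \<ge> N" for m n
    proof -
      have sq: "(norm ((T ^^ k) x))\<^sup>2 = a (k + k) x" for k by (simp add: a_def Let_def)
      have "(norm ((T ^^ m) x - (T ^^ n) x))\<^sup>2 = a (m + m) x + a (n + n) x - 2 * a (m + n) x"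
        using H.norm_diff_sq[OF ip_T_pow] by (simp add: sq)
      also have "\<dots> < e\<^sup>2" using N[of "m + m"] N[of "n + n"] lower[of "m + n"] that by simp
      finally show ?thesis using e by (simp add: power2_less_imp_less)
    qed
    then show "\<exists>M. \<forall>m\<ge>M. \<forall>n\<ge>M. dist ((T ^^ m) x) ((T ^^ n) x) < e" by (auto simp: dist_norm)
  qed
  then show ?thesis using Cauchy_convergent_iff convergent_def by blast
qed

lemma limit_fixed:
  assumes "(\<lambda>n. (T ^^ n) x) \<longlonglongrightarrow> y"
  shows "T y = y"
proof -
  have "(\<lambda>n. T ((T ^^ n) x)) \<longlonglongrightarrow> T y" by (rule bounded_linear.tendsto[OF T_bounded_linear assms])
  moreover have "(\<lambda>n. T ((T ^^ n) x)) \<longlonglongrightarrow> y" using LIMSEQ_Suc[OF assms] by simp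
  ultimately show ?thesis by (rule LIMSEQ_unique)
qed

lemma L_pow: "(norm (L ((T ^^ n) x)))\<^sup>2 = s * a (2 * n + 1) x"
  using s by (simp add: a_def Let_def)

lemma L_pow_le: "(norm (L ((T ^^ n) x)))\<^sup>2 \<le> (norm (L x))\<^sup>2"
  using L_pow[of n x] L_pow[of 0 x] decseqD[OF a_decseq, of 1 "2 * n + 1" x] s by simp

text \<open>Outside a finite \<open>F\<close> the basis sum for \<open>L\<close> is at most
  \<open>e / 2\<close>, and by \<open>L_pow_le\<close> it dominates the tail for
  \<open>L \<circ> T ^^ n\<close> whatever \<open>n\<close> is. Only the finite part over
  \<open>F\<close> calls for a large \<open>n\<close>.\<close>

lemma hs_norm_L_pow_small:
  assumes lim: "\<And>x. (\<lambda>n. (T ^^ n) x) \<longlonglongrightarrow> 0" and e: "0 < e"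
  shows "\<exists>n. \<forall>x. (norm (L ((T ^^ n) x)))\<^sup>2 \<le> e * (norm x)\<^sup>2"
proof -
  let ?E = "some_onb H"
  let ?f = "\<lambda>e. (norm (L e))\<^sup>2"
  have summ: "?f summable_on ?E" using L by (simp add: hs_ops_def)
  then obtain F where F: "finite F" "F \<subseteq> ?E" "dist (sum ?f F) (infsum ?f ?E) \<le> e / 2"
    using infsum_finite_approximation[of ?f ?E "e / 2"] e by auto
  have "(\<lambda>n. L ((T ^^ n) x)) \<longlonglongrightarrow> L 0" for x
    by (rule bounded_linear.tendsto[OF bounded_ops_bounded_linear[OF Lb] lim])
  then have "(\<lambda>n. \<Sum>x\<in>F. (norm (L ((T ^^ n) x)))\<^sup>2) \<longlonglongrightarrow> (\<Sum>x\<in>F. (norm (L 0))\<^sup>2)"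
    by (intro tendsto_intros)
  then have "(\<lambda>n. \<Sum>x\<in>F. (norm (L ((T ^^ n) x)))\<^sup>2) \<longlonglongrightarrow> 0" by (simp add: bounded_ops_zero[OF Lb])
  then have "eventually (\<lambda>n. (\<Sum>x\<in>F. (norm (L ((T ^^ n) x)))\<^sup>2) < e / 2) sequentially"
    using e by (intro order_tendstoD(2)) auto
  then obtain n where n: "(\<Sum>x\<in>F. (norm (L ((T ^^ n) x)))\<^sup>2) < e / 2"
    by (auto simp: eventually_sequentially)
  let ?g = "\<lambda>x. (norm (L ((T ^^ n) x)))\<^sup>2"
  have le: "sum ?g X \<le> e" if X: "finite X" "X \<subseteq> ?E" for X
  proof -
    have "sum ?g X \<le> sum ?g (F \<union> (X - F))" using X F by (intro sum_mono2) auto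
    also have "\<dots> = sum ?g F + sum ?g (X - F)" using X F by (intro sum.union_disjoint) auto
    also have "sum ?g (X - F) \<le> sum ?f (X - F)" by (intro sum_mono L_pow_le)
    also have "sum ?f (X - F) = sum ?f (F \<union> (X - F)) - sum ?f F"
      using X F by (subst sum.union_disjoint) auto
    also have "sum ?f (F \<union> (X - F)) \<le> infsum ?f ?E"
      using X F summ by (intro finite_sum_le_infsum) auto
    also have "infsum ?f ?E - sum ?f F \<le> e / 2" using F(3) unfolding dist_real_def by linarith
    finally show ?thesis using n by simp
  qed
  have LT: "(\<lambda>x. L ((T ^^ n) x)) \<in> bounded_ops H K"
    using bounded_ops_comp[OF T_pow_bounded_ops Lb] by (simp add: o_def)
  have summ': "?g summable_on ?E"
    using le by (intro nonneg_bdd_above_summable_on bdd_aboveI[of _ e]) auto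
  with LT have hs: "(\<lambda>x. L ((T ^^ n) x)) \<in> hs_ops H K" by (simp add: hs_ops_def)
  have "(hs_norm H (\<lambda>x. L ((T ^^ n) x)))\<^sup>2 \<le> e"
    unfolding hs_norm_sq using le summ' by (intro infsum_le_finite_sums) auto
  then have "(norm (L ((T ^^ n) x)))\<^sup>2 \<le> e * (norm x)\<^sup>2" for x
    using norm_le_hs_norm[OF hs, of x] mult_right_mono[of _ e "(norm x)\<^sup>2"]
    by (meson order_trans zero_le_power2)
  then show ?thesis by blast
qed

lemma fixed_point: "\<exists>y. y \<noteq> 0 \<and> T y = y"
proof (rule ccontr)
  assume no: "\<not> (\<exists>y. y \<noteq> 0 \<and> T y = y)"
  have lim: "(\<lambda>n. (T ^^ n) x) \<longlonglongrightarrow> 0" for x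
    using T_pow_convergent[of x] limit_fixed[of x] no by metis
  obtain n where n: "\<And>x. (norm (L ((T ^^ n) x)))\<^sup>2 \<le> s / 2 * (norm x)\<^sup>2"
    using hs_norm_L_pow_small[OF lim, of "s / 2"] s by auto
  define k where "k = real (2 * n + 1)"
  have k: "k \<ge> 1" by (simp add: k_def)
  \<comment> \<open>The threshold makes the first drop of \<open>a\<close> smaller than
    \<open>a 0 x / (2 * k)\<close>. Over \<open>k = 2 * n + 1\<close> steps less than half of
    \<open>a 0 x\<close> is then lost, against the choice of \<open>n\<close>.\<close>
  have "s * (1 - 1 / (2 * k)) < s" using s k by (simp add: field_simps)
  from sharp[OF this] obtain x where x: "s * (1 - 1 / (2 * k)) * (norm x)\<^sup>2 < (norm (L x))\<^sup>2"
    by blast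
  have a0: "a 0 x = (norm x)\<^sup>2" by (simp add: a_def)
  have a1: "a 1 x = (norm (L x))\<^sup>2 / s" by (simp add: a_def)
  have "a (2 * n + 1) x \<le> a 0 x / 2"
    using n[of x] s by (simp only: L_pow a0) (simp add: field_simps)
  then have "a 0 x / 2 \<le> k * (a 0 x - a 1 x)"
    using a_lower[of x "2 * n + 1"] by (simp only: k_def[symmetric])
  then have "a 1 x \<le> a 0 x - a 0 x / (2 * k)" using k by (simp add: field_simps)
  moreover have "a 0 x - a 0 x / (2 * k) < a 1 x"
    using x s k by (simp only: a0 a1) (simp add: field_simps)
  ultimately show False by simp
qed

lemma top_eigenvector:
  "\<exists>u. norm u = 1 \<and> adj H K L (L u) = s *\<^sub>R u \<and> (norm (L u))\<^sup>2 = s"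
proof -
  obtain y where y: "y \<noteq> 0" "T y = y" using fixed_point by blast
  define u where "u = (1 / norm y) *\<^sub>R y"
  have u: "norm u = 1" using y by (simp add: u_def)
  have "T u = u"
    using y(2) linear_scale[OF bounded_linear.linear[OF T_bounded_linear]] by (simp add: u_def)
  moreover have "s *\<^sub>R T u = adj H K L (L u)" using s by (simp add: T_def)
  ultimately have eig: "adj H K L (L u) = s *\<^sub>R u" by simp
  have "of_real ((norm (L u))\<^sup>2) = ip H (adj H K L (L u)) u"
    by (simp add: adj_ip_left[OF Lb] K.ip_self)
  also have "\<dots> = of_real s" using u by (simp add: eig H.ip_scaleR_left H.ip_self scaleR_conv_of_real)
  finally have "(norm (L u))\<^sup>2 = s" by (simp only: of_real_eq_iff)
  with u eig show ?thesis by blast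
qed

end

text \<open>The alternative \<open>u = 0\<close> covers \<open>L = 0\<close>, where even a unit
  vector may be missing because the space can be trivial. It also produces the zero padding of
  singular systems.\<close>

lemma (in hilbert_pair) top_eigenvector:
  assumes L: "L \<in> hs_ops H K"
  shows "\<exists>u. (u = 0 \<or> norm u = 1) \<and> adj H K L (L u) = (norm (L u))\<^sup>2 *\<^sub>R u \<and>
    (\<forall>x. (norm (L x))\<^sup>2 \<le> (norm (L u))\<^sup>2 * (norm x)\<^sup>2)"
proof (cases "onorm L = 0")
  case True
  note Lb = hs_ops_bounded[OF L]
  have "L x = 0" for x
    using onorm[OF bounded_ops_bounded_linear[OF Lb], of x] True by simp
  then show ?thesis
    by (intro exI[of _ 0]) (simp add: bounded_ops_zero[OF adj_bounded_ops[OF Lb]])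
next
  case False
  note bl = bounded_ops_bounded_linear[OF hs_ops_bounded[OF L]]
  have pos: "onorm L > 0" using False onorm_pos_le[OF bl] by linarith
  interpret power_iteration H K L "(onorm L)\<^sup>2"
  proof
    show "L \<in> hs_ops H K" by fact
    show "0 < (onorm L)\<^sup>2" using pos by simp
    show "(norm (L x))\<^sup>2 \<le> (onorm L)\<^sup>2 * (norm x)\<^sup>2" for x
      using power_mono[OF onorm[OF bl, of x], of 2] by (simp add: power_mult_distrib)
    fix c assume c: "c < (onorm L)\<^sup>2"
    show "\<exists>x. c * (norm x)\<^sup>2 < (norm (L x))\<^sup>2"
    proof (rule ccontr)
      assume "\<not> ?thesis"
      then have "(norm (L x))\<^sup>2 \<le> c * (norm x)\<^sup>2" for x by (simp add: not_less)
      \<comment> \<open>\<open>c\<close> may be negative, while the bound on \<open>onorm L\<close>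
        takes a square root.\<close>
      moreover have "c * (norm x)\<^sup>2 \<le> max c 0 * (norm x)\<^sup>2" for x :: 'a
        by (intro mult_right_mono) auto
      ultimately have le: "(norm (L x))\<^sup>2 \<le> max c 0 * (norm x)\<^sup>2" for x
        using order_trans by blast
      have "norm (L x) \<le> sqrt (max c 0) * norm x" for x
        using real_sqrt_le_mono[OF le[of x]] by (simp add: real_sqrt_mult)
      then have "onorm L \<le> sqrt (max c 0)" by (intro onorm_bound) simp_all
      then have "(onorm L)\<^sup>2 \<le> max c 0"
        using power_mono[of "onorm L" "sqrt (max c 0)" 2] pos by simp
      then show False using c pos by (auto simp: max_def split: if_splits)
    qed
  qed
  show ?thesis using top_eigenvector bound by metis
qed

section \<open>Singular systems and best approximation\<close>

context hilbert_pair
begin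

text \<open>
  For a self-adjoint compact operator of the form \<open>L\<^sup>* L\<close>: eigenvectors listed by decreasing
  eigenvalue, and padded with zeros if there are only finitely many with positive eigenvalue.
\<close>

definition singular_system :: "('a \<Rightarrow> 'b) \<Rightarrow> (nat \<Rightarrow> 'a) \<Rightarrow> bool" where
  "singular_system L g \<longleftrightarrow> H.onf UNIV g \<and>
     (\<forall>i. adj H K L (L (g i)) = (norm (L (g i)))\<^sup>2 *\<^sub>R g i) \<and>
     (\<forall>n x. x \<in> orth_compl H (g ` {..<n}) \<longrightarrow> (norm (L x))\<^sup>2 \<le> (norm (L (g n)))\<^sup>2 * (norm x)\<^sup>2)"

text \<open>The members of \<open>W\<close> are eigenvectors, so their orthogonal complement is
  invariant under \<open>adj H K L \<circ> L\<close>. Composing \<open>L\<close> with the projector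
  onto it stays Hilbert--Schmidt, and by invariance a top eigenvector of the compressed operator is
  one of the original operator on the complement.\<close>

lemma top_eigenvector_orth_compl:
  assumes L: "L \<in> hs_ops H K" and W: "\<And>w. w \<in> W \<Longrightarrow> \<exists>t. adj H K L (L w) = t *\<^sub>R w"
  shows "\<exists>u. u \<in> orth_compl H W \<and> (u = 0 \<or> norm u = 1) \<and>
    adj H K L (L u) = (norm (L u))\<^sup>2 *\<^sub>R u \<and>
    (\<forall>x\<in>orth_compl H W. (norm (L x))\<^sup>2 \<le> (norm (L u))\<^sup>2 * (norm x)\<^sup>2)"
proof -
  note Lb = hs_ops_bounded[OF L]
  define V where "V = orth_compl H W"
  define P where "P = orth_proj H V"
  have V: "H.subspace V" "closed V"
    by (auto simp: V_def H.subspace_orth_compl H.closed_orth_compl)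
  have PV: "P x = x" if "x \<in> V" for x unfolding P_def by (rule H.orth_proj_id[OF V(1) that])
  have LP: "L \<circ> P \<in> hs_ops H K" unfolding P_def by (rule hs_pythagoras_right(1)[OF L V])
  have adjLP: "adj H K (L \<circ> P) = P \<circ> adj H K L"
    by (intro ext adjI) (simp add: P_def adj_ip[OF Lb] H.orth_proj_selfadj[OF V])
  obtain u where u: "u = 0 \<or> norm u = 1"
      "P (adj H K L (L (P u))) = (norm (L (P u)))\<^sup>2 *\<^sub>R u"
      "\<And>x. (norm (L (P x)))\<^sup>2 \<le> (norm (L (P u)))\<^sup>2 * (norm x)\<^sup>2"
    using top_eigenvector[OF LP] by (auto simp: adjLP)
  show ?thesis
  proof (cases "L (P u) = 0")
    case True
    \<comment> \<open>In this case \<open>u\<close> may lie outside \<open>V\<close>; as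
      \<open>L\<close> vanishes on \<open>V\<close>, the zero vector serves instead.\<close>
    then have "L x = 0" if "x \<in> V" for x using u(3)[of x] PV[OF that] by simp
    then show ?thesis
      by (intro exI[of _ 0])
        (auto simp: bounded_ops_zero[OF Lb] bounded_ops_zero[OF adj_bounded_ops[OF Lb]]
          H.subspace_0[OF V(1)] simp flip: V_def)
  next
    case False
    \<comment> \<open>An eigenvector for a nonzero eigenvalue is a multiple of its image, and the
      image lies in \<open>V\<close>.\<close>
    have "P (adj H K L (L (P u))) \<in> V" unfolding P_def by (rule H.orth_proj_in[OF V])
    then have "scal H (of_real (1 / (norm (L (P u)))\<^sup>2)) ((norm (L (P u)))\<^sup>2 *\<^sub>R u) \<in> V"
      unfolding u(2) by (rule H.subspace_scale[OF V(1)])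
    then have uV: "u \<in> V" using False by (simp only: H.scal_of_real) simp
    have "ip H (adj H K L (L u)) w = 0" if w: "w \<in> W" for w
    proof -
      obtain t where "adj H K L (L w) = t *\<^sub>R w" using W[OF w] by blast
      then have "ip H (adj H K L (L u)) w = t *\<^sub>R ip H u w"
        by (simp add: adj_ip_left[OF Lb] adj_ip[OF Lb] H.ip_scaleR_right)
      then show ?thesis using uV w by (auto simp: V_def orth_compl_def)
    qed
    then have "adj H K L (L u) \<in> V" by (simp add: V_def orth_compl_def)
    then have "adj H K L (L u) = (norm (L u))\<^sup>2 *\<^sub>R u" using u(2) PV uV by simp
    moreover have "(norm (L x))\<^sup>2 \<le> (norm (L u))\<^sup>2 * (norm x)\<^sup>2" if "x \<in> V" for x
      using u(3)[of x] PV uV that by simp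
    ultimately show ?thesis using u(1) uV unfolding V_def by blast
  qed
qed

text \<open>Dependent choice along the natural numbers: the requirement on the \<open>n\<close>-th
  vector refers only to the earlier ones, and these are eigenvectors, as the extension lemma
  demands.\<close>

theorem singular_system_exists:
  assumes L: "L \<in> hs_ops H K"
  shows "\<exists>g. singular_system L g"
proof -
  let ?Q = "\<lambda>g (n::nat) u. u \<in> orth_compl H (g ` {..<n}) \<and> (u = 0 \<or> norm u = 1) \<and>
    adj H K L (L u) = (norm (L u))\<^sup>2 *\<^sub>R u \<and>
    (\<forall>x\<in>orth_compl H (g ` {..<n}). (norm (L x))\<^sup>2 \<le> (norm (L u))\<^sup>2 * (norm x)\<^sup>2)"
  have "\<exists>g. \<forall>n. ?Q g n (g n)"
  proof (rule dependent_wellorder_choice)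
    fix u n and g h :: "nat \<Rightarrow> 'a"
    assume "\<And>m. m < n \<Longrightarrow> g m = h m"
    then have "g ` {..<n} = h ` {..<n}" by (auto simp: image_iff)
    then show "?Q g n u = ?Q h n u" by simp
  next
    fix n and g :: "nat \<Rightarrow> 'a"
    assume "\<And>m. m < n \<Longrightarrow> ?Q g m (g m)"
    then show "\<exists>u. ?Q g n u" by (intro top_eigenvector_orth_compl[OF L]) blast
  qed
  then obtain g where g: "\<And>n. ?Q g n (g n)" by blast
  have less: "ip H (g i) (g j) = 0" if "j < i" for i j
    using g[of i] that by (auto simp: orth_compl_def)
  have "H.onf UNIV g" unfolding H.onf_def
  proof (intro ballI)
    fix i j :: nat
    consider "i = j" | "j < i" | "i < j" by linarith
    then show "ip H (g i) (g j) = (if i = j \<and> g i \<noteq> 0 then 1 else 0)"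
    proof cases
      case 1
      have "g i = 0 \<or> norm (g i) = 1" using g by blast
      with 1 show ?thesis by (auto simp: H.ip_self)
    next
      case 2
      then show ?thesis using less by simp
    next
      case 3
      then show ?thesis using less[of i j] H.ip_eq_0_commute[of "g i" "g j"] by simp
    qed
  qed
  then show ?thesis using g unfolding singular_system_def by blast
qed

context
  fixes L g
  assumes L: "L \<in> hs_ops H K" and g: "singular_system L g"
begin

lemma singular_onf: "H.onf I g"
  using g H.onf_subset[of UNIV g I] by (simp add: singular_system_def)

lemma singular_eq: "adj H K L (L (g i)) = (norm (L (g i)))\<^sup>2 *\<^sub>R g i"
  using g by (simp add: singular_system_def)

lemma singular_bound:
  "x \<in> orth_compl H (g ` {..<n}) \<Longrightarrow> (norm (L x))\<^sup>2 \<le> (norm (L (g n)))\<^sup>2 * (norm x)\<^sup>2"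
  using g by (simp add: singular_system_def)

lemma singular_decseq: "decseq (\<lambda>i. (norm (L (g i)))\<^sup>2)"
proof (rule decseq_SucI)
  fix n
  have "g (Suc n) \<in> orth_compl H (g ` {..<n})"
    using singular_onf[of UNIV] by (auto simp: H.onf_def orth_compl_def)
  then have "(norm (L (g (Suc n))))\<^sup>2 \<le> (norm (L (g n)))\<^sup>2 * (norm (g (Suc n)))\<^sup>2"
    by (rule singular_bound)
  also have "\<dots> \<le> (norm (L (g n)))\<^sup>2 * 1"
    using H.onf_norm_le[OF singular_onf[of UNIV]] by (intro mult_left_mono power_le_one) auto
  finally show "(norm (L (g (Suc n))))\<^sup>2 \<le> (norm (L (g n)))\<^sup>2" by simp
qed

lemma singular_sum_le: "(\<Sum>i<n. (norm (L (g i)))\<^sup>2) \<le> (hs_norm H L)\<^sup>2"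
proof -
  interpret KH: hilbert_pair K H ..
  have "(hs_norm K (adj H K L))\<^sup>2 \<ge> (\<Sum>i<n. (norm (adj K H (adj H K L) (g i)))\<^sup>2)"
    using KH.hs_pythagoras_onf(1)[OF adj_hs(1)[OF L] _ singular_onf, of "{..<n}"] by simp
  then show ?thesis
    by (simp add: adj_hs(2)[OF L] adj_adj[OF hilbert_pair_axioms hs_ops_bounded[OF L]])
qed

text \<open>If all values were at least \<open>t\<close>, their partial sums would outgrow the
  Hilbert--Schmidt norm. This is where compactness enters the description of the
  eigenspaces.\<close>

lemma singular_small:
  assumes t: "0 < t"
  shows "\<exists>n. (norm (L (g n)))\<^sup>2 < t"
proof (rule ccontr)
  assume "\<not> ?thesis"
  then have "real n * t \<le> (\<Sum>i<n. (norm (L (g i)))\<^sup>2)" for n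
    using sum_mono[of "{..<n}" "\<lambda>_. t" "\<lambda>i. (norm (L (g i)))\<^sup>2"] by (simp add: not_less)
  then have "real n * t \<le> (hs_norm H L)\<^sup>2" for n using singular_sum_le order_trans by blast
  moreover obtain n where "(hs_norm H L)\<^sup>2 < real n * t" using t ex_less_of_nat_mult by blast
  ultimately show False by (meson not_less)
qed

lemma singular_finite:
  assumes t: "0 < t"
  shows "finite {i. (norm (L (g i)))\<^sup>2 = t}"
proof -
  obtain n where n: "(norm (L (g n)))\<^sup>2 < t" using singular_small[OF t] by blast
  have "{i. (norm (L (g i)))\<^sup>2 = t} \<subseteq> {..<n}"
  proof
    fix i assume "i \<in> {i. (norm (L (g i)))\<^sup>2 = t}"
    then show "i \<in> {..<n}" using n decseqD[OF singular_decseq, of n i] by (cases "i < n") auto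
  qed
  then show ?thesis using finite_subset by blast
qed

text \<open>The listed eigenvectors exhaust the eigenspace. The part \<open>y\<close> of an
  eigenvector not captured by them is again an eigenvector for \<open>t\<close> and orthogonal to
  every \<open>g i\<close>, for different eigenvalues by self-adjointness. The bound at an index
  whose value is below \<open>t\<close> then contradicts
  \<open>(norm (L y))\<^sup>2 = t * (norm y)\<^sup>2\<close> unless \<open>y = 0\<close>.\<close>

lemma singular_eigenspace:
  assumes t: "0 < t"
  shows "H.span (g ` {i. (norm (L (g i)))\<^sup>2 = t}) = {x. adj H K L (L x) = t *\<^sub>R x}"
proof -
  note Lb = hs_ops_bounded[OF L]
  define I where "I = {i. (norm (L (g i)))\<^sup>2 = t}"
  define A where "A x = adj H K L (L x)" for x
  have sub: "H.subspace {x. A x = t *\<^sub>R x}"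
    by (rule H.subspaceI) (auto simp: A_def bounded_ops_zero[OF Lb]
        bounded_ops_zero[OF adj_bounded_ops[OF Lb]] bounded_ops_add[OF Lb]
        bounded_ops_add[OF adj_bounded_ops[OF Lb]] bounded_ops_scal[OF Lb]
        bounded_ops_scal[OF adj_bounded_ops[OF Lb]] scaleR_right_distrib H.scal_scaleR)
  have sp: "H.span (g ` I) \<subseteq> {x. A x = t *\<^sub>R x}"
    by (rule H.span_minimal[OF _ sub]) (auto simp: I_def A_def singular_eq)
  have "x \<in> H.span (g ` I)" if x: "A x = t *\<^sub>R x" for x
  proof -
    note fin = singular_finite[OF t, folded I_def]
    define y where "y = x - H.onf_proj I g x"
    have y: "A y = t *\<^sub>R y"
      using H.subspace_diff[OF sub, of x] sp H.onf_proj_in_span[OF fin singular_onf, of x] x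
      by (auto simp: y_def)
    have orth: "ip H y (g i) = 0" for i
    proof (cases "i \<in> I")
      case True
      then show ?thesis using H.diff_onf_proj_orth[OF fin singular_onf, of x]
        by (auto simp: y_def orth_compl_def)
    next
      case False
      have "t *\<^sub>R ip H y (g i) = ip H (A y) (g i)" by (simp add: y H.ip_scaleR_left)
      also have "\<dots> = ip H y (A (g i))" by (simp add: A_def adj_ip_left[OF Lb] adj_ip[OF Lb])
      also have "\<dots> = (norm (L (g i)))\<^sup>2 *\<^sub>R ip H y (g i)"
        by (simp add: A_def singular_eq H.ip_scaleR_right)
      finally show ?thesis using False by (auto simp: I_def)
    qed
    obtain n where n: "(norm (L (g n)))\<^sup>2 < t" using singular_small[OF t] by blast
    have "(norm (L y))\<^sup>2 \<le> (norm (L (g n)))\<^sup>2 * (norm y)\<^sup>2"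
      by (rule singular_bound) (auto simp: orth_compl_def orth)
    moreover have "(norm (L y))\<^sup>2 = t * (norm y)\<^sup>2"
    proof -
      have "of_real ((norm (L y))\<^sup>2) = ip H (A y) y"
        by (simp add: A_def adj_ip_left[OF Lb] K.ip_self)
      also have "\<dots> = of_real (t * (norm y)\<^sup>2)"
        by (simp add: y H.ip_scaleR_left H.ip_self scaleR_conv_of_real)
      finally show ?thesis by (simp only: of_real_eq_iff)
    qed
    ultimately have "(t - (norm (L (g n)))\<^sup>2) * (norm y)\<^sup>2 \<le> 0" by (simp add: algebra_simps)
    then have "y = 0" using n by (simp add: mult_le_0_iff)
    then have "x = H.onf_proj I g x" by (simp add: y_def)
    then show ?thesis using H.onf_proj_in_span[OF fin singular_onf, of x] by simp
  qed
  then show ?thesis using sp by (auto simp: I_def A_def)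
qed

lemma singular_has_dim:
  assumes t: "0 < t"
  shows "has_dim H {x. adj H K L (L x) = t *\<^sub>R x} (card {i. (norm (L (g i)))\<^sup>2 = t})"
proof -
  let ?I = "{i. (norm (L (g i)))\<^sup>2 = t}"
  have "g i \<noteq> 0" if "i \<in> ?I" for i
    using that t bounded_ops_zero[OF hs_ops_bounded[OF L]] by auto
  then have "inj_on g ?I" "H.independent (g ` ?I)"
    using H.onf_independent[OF singular_onf, of ?I] by blast+
  then show ?thesis unfolding has_dim_def singular_eigenspace[OF t, symmetric]
    using singular_finite[OF t] by (intro exI[of _ "g ` ?I"]) (auto simp: card_image)
qed

text \<open>With \<open>p\<close> the projection of \<open>v\<close> onto the first \<open>r\<close>
  eigenvectors and \<open>w\<close> the rest, \<open>L p\<close> and \<open>L w\<close> are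
  orthogonal because the span of eigenvectors is invariant. The first part is computed, the second
  estimated by the value at index \<open>r\<close>, the first one beyond the projection.\<close>

lemma norm_sq_split:
  "(norm (L v))\<^sup>2 \<le> (\<Sum>i<r. (norm (L (g i)))\<^sup>2 * (norm (ip H v (g i)))\<^sup>2)
     + (norm (L (g r)))\<^sup>2 * ((norm v)\<^sup>2 - (\<Sum>i<r. (norm (ip H v (g i)))\<^sup>2))"
proof -
  note Lb = hs_ops_bounded[OF L]
  let ?f = "\<lambda>i. (norm (L (g i)))\<^sup>2"
  let ?c = "\<lambda>i. ip H v (g i)"
  define p where "p = H.onf_proj {..<r} g v"
  define w where "w = v - p"
  note on = finite_lessThan[of r] singular_onf[of "{..<r}"]
  have Ap: "adj H K L (L p) = (\<Sum>i<r. scal H (?c i) (?f i *\<^sub>R g i))"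
  proof -
    have "adj H K L (L (\<Sum>i\<in>I. scal H (?c i) (g i)))
        = (\<Sum>i\<in>I. scal H (?c i) (adj H K L (L (g i))))" if "finite I" for I
      using that by (induction I) (simp_all add: bounded_ops_zero[OF Lb]
          bounded_ops_zero[OF adj_bounded_ops[OF Lb]] bounded_ops_add[OF Lb]
        bounded_ops_add[OF adj_bounded_ops[OF Lb]] bounded_ops_scal[OF Lb]
        bounded_ops_scal[OF adj_bounded_ops[OF Lb]])
    then show ?thesis by (simp add: p_def H.onf_proj_def singular_eq)
  qed
  have gw: "ip H (g i) w = 0" if "i < r" for i
    using H.diff_onf_proj_orth[OF on, of v] that H.ip_eq_0_commute[of w "g i"]
    by (auto simp: w_def p_def orth_compl_def)
  have "ip K (L p) (L w) = 0"
    by (simp add: Ap adj_ip[OF Lb] H.ip_sum_left H.ip_scal_left H.ip_scaleR_left gw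
        flip: adj_ip_left[OF Lb])
  then have "(norm (L (p + w)))\<^sup>2 = (norm (L p))\<^sup>2 + (norm (L w))\<^sup>2"
    by (simp add: bounded_ops_add[OF Lb] K.pythagoras)
  moreover have "(norm (L p))\<^sup>2 = (\<Sum>i<r. ?f i * (norm (?c i))\<^sup>2)"
  proof -
    have "of_real ((norm (L p))\<^sup>2) = ip H (adj H K L (L p)) p"
      by (simp add: adj_ip_left[OF Lb] K.ip_self)
    also have "\<dots> = (\<Sum>i<r. ?c i * (?f i *\<^sub>R ip H (g i) p))"
      by (simp add: Ap H.ip_sum_left H.ip_scal_left H.ip_scaleR_left)
    also have "\<dots> = (\<Sum>i<r. of_real (?f i) * (?c i * conj (?c i)))"
    proof (intro sum.cong refl)
      fix i assume "i \<in> {..<r}"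
      then have "ip H (g i) p = conj (?c i)"
        using H.ip_commute[of "g i" p] by (simp add: p_def H.ip_onf_proj[OF on])
      then show "?c i * (?f i *\<^sub>R ip H (g i) p) = of_real (?f i) * (?c i * conj (?c i))"
        by (simp add: scaleR_conv_of_real)
    qed
    also have "\<dots> = of_real (\<Sum>i<r. ?f i * (norm (?c i))\<^sup>2)"
      by (simp add: mult_conj)
    finally show ?thesis by (simp only: of_real_eq_iff)
  qed
  moreover have "(norm (L w))\<^sup>2 \<le> ?f r * (norm w)\<^sup>2"
    unfolding w_def p_def by (rule singular_bound[OF H.diff_onf_proj_orth[OF on]])
  moreover have "(norm w)\<^sup>2 = (norm v)\<^sup>2 - (\<Sum>i<r. (norm (?c i))\<^sup>2)"
    using H.bessel_eq[OF on, of v] by (simp add: w_def p_def)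
  ultimately show ?thesis by (simp add: w_def)
qed

text \<open>Subtracting the value at index \<open>r\<close> leaves nonnegative weights on the first
  \<open>r\<close> indices, so Bessel for the family \<open>F\<close> at each \<open>g i\<close> may
  replace the total coefficient there by 1. The subtracted constant is charged once per member of
  \<open>F\<close>, hence at most \<open>r\<close> times.\<close>

theorem ky_fan:
  assumes F: "finite F" "card F \<le> r" "H.onf F (\<lambda>v. v)"
  shows "(\<Sum>v\<in>F. (norm (L v))\<^sup>2) \<le> (\<Sum>i<r. (norm (L (g i)))\<^sup>2)"
proof -
  let ?f = "\<lambda>i. (norm (L (g i)))\<^sup>2"
  let ?c = "\<lambda>v i. (norm (ip H v (g i)))\<^sup>2"
  have "(norm (L v))\<^sup>2 \<le> (\<Sum>i<r. (?f i - ?f r) * ?c v i) + ?f r" if v: "v \<in> F" for v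
  proof -
    have "(norm (L v))\<^sup>2 \<le> (\<Sum>i<r. ?f i * ?c v i) + ?f r * ((norm v)\<^sup>2 - (\<Sum>i<r. ?c v i))"
      by (rule norm_sq_split)
    also have "\<dots> \<le> (\<Sum>i<r. ?f i * ?c v i) + ?f r * (1 - (\<Sum>i<r. ?c v i))"
      using H.onf_norm_le[OF F(3) v] by (intro add_left_mono mult_left_mono) (auto simp: power_le_one)
    also have "\<dots> = (\<Sum>i<r. (?f i - ?f r) * ?c v i) + ?f r"
      by (simp add: algebra_simps sum_subtractf sum_distrib_left)
    finally show ?thesis .
  qed
  then have "(\<Sum>v\<in>F. (norm (L v))\<^sup>2) \<le> (\<Sum>v\<in>F. (\<Sum>i<r. (?f i - ?f r) * ?c v i) + ?f r)"
    by (rule sum_mono)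
  also have "\<dots> = (\<Sum>i<r. (?f i - ?f r) * (\<Sum>v\<in>F. ?c v i)) + real (card F) * ?f r"
    by (simp add: sum.distrib sum_distrib_left) (rule sum.swap)
  also have "\<dots> \<le> (\<Sum>i<r. (?f i - ?f r) * 1) + real r * ?f r"
  proof (intro add_mono sum_mono mult_left_mono mult_right_mono)
    fix i assume "i \<in> {..<r}"
    then show "0 \<le> ?f i - ?f r" using decseqD[OF singular_decseq, of i r] by simp
    have "(\<Sum>v\<in>F. ?c v i) \<le> (norm (g i))\<^sup>2"
      using H.bessel_le[OF F(1,3), of "g i"] by (simp add: H.norm_ip_commute[of "g i"])
    also have "\<dots> \<le> 1" using H.onf_norm_le[OF singular_onf[of UNIV], of i] by (simp add: power_le_one)
    finally show "(\<Sum>v\<in>F. ?c v i) \<le> 1" .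
  qed (use F in auto)
  also have "\<dots> = (\<Sum>i<r. ?f i)" by (simp add: sum_subtractf)
  finally show ?thesis .
qed

end

end

text \<open>Here the singular system belongs to the adjoint, so that it consists of left singular vectors.\<close>

theorem (in hilbert_pair) eckart_young:
  assumes T: "T \<in> hs_ops H K" and g: "hilbert_pair.singular_system K H (adj H K T) g"
  shows "\<exists>Z\<in>rank_le_ops H K r. (hs_norm H (\<lambda>x. T x - Z x))\<^sup>2
      = (hs_norm H T)\<^sup>2 - (\<Sum>i<r. (norm (adj H K T (g i)))\<^sup>2)"
    and "Z \<in> rank_le_ops H K r \<Longrightarrow>
      (hs_norm H T)\<^sup>2 - (\<Sum>i<r. (norm (adj H K T (g i)))\<^sup>2) \<le> (hs_norm H (\<lambda>x. T x - Z x))\<^sup>2"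
proof -
  interpret KH: hilbert_pair K H ..
  note A = adj_hs(1)[OF T]
  note on = KH.singular_onf[OF A g]
  note Tb = hs_ops_bounded[OF T]
  show "\<exists>Z\<in>rank_le_ops H K r. (hs_norm H (\<lambda>x. T x - Z x))\<^sup>2
      = (hs_norm H T)\<^sup>2 - (\<Sum>i<r. (norm (adj H K T (g i)))\<^sup>2)"
  proof (rule bexI[of _ "K.onf_proj {..<r} g \<circ> T"])
    show "K.onf_proj {..<r} g \<circ> T \<in> rank_le_ops H K r"
    proof (rule rank_le_opsI)
      show "K.onf_proj {..<r} g \<circ> T \<in> bounded_ops H K"
        by (intro bounded_ops_comp[OF Tb] K.onf_proj_bounded_ops on) simp
      show "range (K.onf_proj {..<r} g \<circ> T) \<subseteq> K.span (g ` {..<r})"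
        using K.onf_proj_in_span[OF _ on] by auto
      show "card (g ` {..<r}) \<le> r" using card_image_le[of "{..<r}" g] by simp
    qed simp
    show "(hs_norm H (\<lambda>x. T x - (K.onf_proj {..<r} g \<circ> T) x))\<^sup>2
      = (hs_norm H T)\<^sup>2 - (\<Sum>i<r. (norm (adj H K T (g i)))\<^sup>2)"
      using hs_pythagoras_onf(1)[OF T _ on, of "{..<r}"] by simp
  qed
  assume Z: "Z \<in> rank_le_ops H K r"
  obtain F where F: "finite F" "card F \<le> r" "K.onf F (\<lambda>f. f)" "range Z \<subseteq> K.span F"
    by (rule rank_le_spanD[OF Z])
  note TP = hs_pythagoras_onf[OF T F(1,3)]
  \<comment> \<open>Among operators with values in the span of \<open>F\<close>, projecting
    \<open>T e\<close> is optimal at each basis vector separately.\<close>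
  have "(hs_norm H (\<lambda>x. T x - K.onf_proj F (\<lambda>f. f) (T x)))\<^sup>2 \<le> (hs_norm H (\<lambda>x. T x - Z x))\<^sup>2"
  proof (rule has_sum_mono[OF hs_norm_has_sum hs_norm_has_sum])
    show "(\<lambda>x. T x - K.onf_proj F (\<lambda>f. f) (T x)) \<in> hs_ops H K" by (rule TP(2))
    show "(\<lambda>x. T x - Z x) \<in> hs_ops H K" by (intro hs_ops_sub T rank_le_hs_ops[OF Z])
    show "(norm (T e - K.onf_proj F (\<lambda>f. f) (T e)))\<^sup>2 \<le> (norm (T e - Z e))\<^sup>2" for e
      using F(4) by (intro K.onf_proj_best F(1,3)) auto
  qed
  then show "(hs_norm H T)\<^sup>2 - (\<Sum>i<r. (norm (adj H K T (g i)))\<^sup>2) \<le> (hs_norm H (\<lambda>x. T x - Z x))\<^sup>2"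
    using KH.ky_fan[OF A g F(1,2,3)] TP(1) by linarith
qed

section \<open>Eigenvalue sequences\<close>

context hilbert_space
begin

text \<open>For self-adjoint \<open>D\<close>, pairing \<open>D (D x) = 0\<close> with
  \<open>x\<close> gives \<open>D x = 0\<close>, so chains of generalized eigenvectors have length
  one and algebraic multiplicity is the dimension of the eigenspace.\<close>

lemma gen_eigenspace_selfadj:
  assumes A: "A \<in> bounded_ops H H" and sa: "\<And>x y. ip H (A x) y = ip H x (A y)"
  shows "gen_eigenspace H A (of_real t) = {x. A x = t *\<^sub>R x}"
proof -
  define D where "D x = A x - t *\<^sub>R x" for x
  have D_sa: "ip H (D x) y = ip H x (D y)" for x y
    by (simp add: D_def ip_diff_left ip_diff_right ip_scaleR_left ip_scaleR_right sa)
  have D2: "D x = 0" if "D (D x) = 0" for x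
  proof -
    have "ip H (D x) (D x) = ip H (D (D x)) x" by (simp add: D_sa)
    then show ?thesis by (simp add: that ip_self)
  qed
  have D0: "D 0 = 0" by (simp add: D_def bounded_ops_zero[OF A])
  have Dn: "D x = 0" if "(D ^^ n) x = 0" for n x
    using that
  proof (induction n)
    case (Suc n)
    show ?case
    proof (cases n)
      case 0
      then show ?thesis using Suc.prems by simp
    next
      case (Suc m)
      then have "D (D ((D ^^ m) x)) = 0" using Suc.prems by simp
      then have "(D ^^ n) x = 0" using D2 Suc by simp
      then show ?thesis by (rule Suc.IH)
    qed
  qed (simp add: D0)
  have "gen_eigenspace H A (of_real t) = {x. \<exists>n. (D ^^ n) x = 0}"
    by (simp add: gen_eigenspace_def scal_of_real D_def[abs_def])
  also have "\<dots> = {x. D x = 0}"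
  proof (intro Collect_cong iffI)
    show "\<exists>n. (D ^^ n) x = 0" if "D x = 0" for x using that by (intro exI[of _ 1]) simp
  qed (use Dn in blast)
  also have "\<dots> = {x. A x = t *\<^sub>R x}" by (simp add: D_def)
  finally show ?thesis .
qed

text \<open>Suppose \<open>g\<close> were larger at \<open>i\<close>, with value \<open>t\<close>.
  Then \<open>f\<close> can take the value \<open>t\<close> only before \<open>i\<close>, where both
  sequences agree, so \<open>f\<close> takes it less often than \<open>g\<close>, although both
  counts are the same dimension.\<close>

lemma is_eigval_seq_le:
  assumes f: "is_eigval_seq H A f" and g: "is_eigval_seq H A g" and eq: "\<And>j. j < i \<Longrightarrow> f j = g j"
  shows "g i \<le> f i"
proof (rule ccontr)
  define t where "t = g i"
  assume "\<not> g i \<le> f i"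
  then have less: "f i < t" by (simp add: t_def)
  have t: "t > 0" using less f by (auto simp: is_eigval_seq_def intro: le_less_trans)
  have card: "card {j. f j = t} = card {j. g j = t}"
    using f g t has_dim_unique unfolding is_eigval_seq_def by blast
  have fin: "finite {j. g j = t}" using g t unfolding is_eigval_seq_def by blast
  have "{j. f j = t} \<subseteq> {j. g j = t} - {i}"
  proof
    fix j assume j: "j \<in> {j. f j = t}"
    have "j < i"
    proof (rule ccontr)
      assume "\<not> j < i"
      then have "f j \<le> f i" using f by (auto simp: is_eigval_seq_def decseq_def)
      then show False using j less by simp
    qed
    then show "j \<in> {j. g j = t} - {i}" using eq j by auto
  qed
  then have "card {j. f j = t} \<le> card ({j. g j = t} - {i})" using fin by (intro card_mono) auto
  also have "\<dots> < card {j. g j = t}" using fin by (intro card_Diff1_less) (auto simp: t_def)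
  finally show False using card by simp
qed

lemma is_eigval_seq_unique:
  assumes "is_eigval_seq H A f" "is_eigval_seq H A g"
  shows "f = g"
proof
  fix i show "f i = g i"
  proof (induction i rule: less_induct)
    case (less i)
    then show ?case
      using is_eigval_seq_le[OF assms, of i] is_eigval_seq_le[OF assms(2,1), of i] by force
  qed
qed

lemma eigval_eqI: "is_eigval_seq H A f \<Longrightarrow> eigval H A = f"
  unfolding eigval_def using is_eigval_seq_unique by blast

end

section \<open>Eigenvalues of \<open>adj H K L \<circ> L\<close>, of its square, and of swapped
  products\<close>

context hilbert_pair
begin

context
  fixes L
  assumes L: "L \<in> bounded_ops H K"
begin

lemma adj_comp_bounded_ops: "adj H K L \<circ> L \<in> bounded_ops H H"
  by (rule bounded_ops_comp[OF L adj_bounded_ops[OF L]])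

lemma adj_comp_selfadj: "ip H ((adj H K L \<circ> L) x) y = ip H x ((adj H K L \<circ> L) y)"
  by (simp add: adj_ip[OF L] adj_ip_left[OF L])

lemma gen_eigenspace_adj_comp:
  "gen_eigenspace H (adj H K L \<circ> L) (of_real t) = {x. adj H K L (L x) = t *\<^sub>R x}"
  by (simp only: H.gen_eigenspace_selfadj[OF adj_comp_bounded_ops adj_comp_selfadj] o_apply)

text \<open>Writing \<open>A\<close> for the positive operator, factor \<open>A^2 - t^2\<close> into
  \<open>A + t\<close> and \<open>A - t\<close>: a nonzero \<open>z = A x - t x\<close> would be an
  eigenvector of \<open>A\<close> for the negative number \<open>-t\<close>.\<close>

lemma gen_eigenspace_adj_comp_sq:
  assumes t: "0 < t"
  shows "gen_eigenspace H ((adj H K L \<circ> L) \<circ> (adj H K L \<circ> L)) (of_real (t\<^sup>2))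
    = gen_eigenspace H (adj H K L \<circ> L) (of_real t)"
proof -
  let ?A = "adj H K L \<circ> L"
  have "gen_eigenspace H (?A \<circ> ?A) (of_real (t\<^sup>2)) = {x. (?A \<circ> ?A) x = t\<^sup>2 *\<^sub>R x}"
    by (intro H.gen_eigenspace_selfadj bounded_ops_comp[OF adj_comp_bounded_ops adj_comp_bounded_ops])
      (simp only: o_apply[of ?A ?A] adj_comp_selfadj)
  also have "\<dots> = {x. ?A x = t *\<^sub>R x}"
  proof (intro Collect_cong iffI)
    note scaleR = linear_scale[OF bounded_linear.linear[OF bounded_ops_bounded_linear[OF adj_comp_bounded_ops]]]
    show "(?A \<circ> ?A) x = t\<^sup>2 *\<^sub>R x" if "?A x = t *\<^sub>R x" for x
      unfolding o_apply[of ?A ?A] that scaleR by (simp add: power2_eq_square)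
    fix x assume x: "(?A \<circ> ?A) x = t\<^sup>2 *\<^sub>R x"
    define z where "z = ?A x - t *\<^sub>R x"
    have "?A z = - t *\<^sub>R z"
      using x unfolding z_def bounded_ops_diff[OF adj_comp_bounded_ops] scaleR o_apply[of ?A ?A]
      by (simp add: power2_eq_square scaleR_diff_right)
    then have "ip H (?A z) z = of_real (- t * (norm z)\<^sup>2)"
      by (simp add: H.ip_scaleR_left H.ip_minus_left H.ip_self scaleR_conv_of_real)
    moreover have "ip H (?A z) z = of_real ((norm (L z))\<^sup>2)"
      by (simp add: adj_ip_left[OF L] K.ip_self)
    ultimately have "(norm (L z))\<^sup>2 = - t * (norm z)\<^sup>2" by (metis of_real_eq_iff)
    then have "t * (norm z)\<^sup>2 \<le> 0" using zero_le_power2[of "norm (L z)"] by linarith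
    then have "z = 0" using t by (simp add: mult_le_0_iff)
    then show "?A x = t *\<^sub>R x" by (simp add: z_def)
  qed
  also have "\<dots> = gen_eigenspace H ?A (of_real t)" by (simp add: gen_eigenspace_adj_comp)
  finally show ?thesis .
qed

lemma is_eigval_seq_adj_comp_sq:
  assumes f: "is_eigval_seq H (adj H K L \<circ> L) f"
  shows "is_eigval_seq H ((adj H K L \<circ> L) \<circ> (adj H K L \<circ> L)) (\<lambda>i. (f i)\<^sup>2)"
proof -
  have pos: "0 \<le> f i" for i using f by (simp add: is_eigval_seq_def)
  have "decseq (\<lambda>i. (f i)\<^sup>2)"
    using f pos by (auto simp: is_eigval_seq_def decseq_def intro: power_mono)
  moreover have "finite {i. (f i)\<^sup>2 = t} \<and> has_dim H
      (gen_eigenspace H ((adj H K L \<circ> L) \<circ> (adj H K L \<circ> L)) (of_real t)) (card {i. (f i)\<^sup>2 = t})"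
    if t: "t > 0" for t
  proof -
    have iff: "(f i)\<^sup>2 = t \<longleftrightarrow> f i = sqrt t" for i
      using pos[of i] t by (metis real_sqrt_pow2 real_sqrt_unique less_imp_le)
    have "sqrt t > 0" "of_real t = (of_real ((sqrt t)\<^sup>2) :: 'k)" using t by auto
    then show ?thesis
      using f gen_eigenspace_adj_comp_sq[of "sqrt t"] unfolding iff is_eigval_seq_def by metis
  qed
  ultimately show ?thesis by (simp add: is_eigval_seq_def)
qed

end

lemma singular_is_eigval_seq:
  assumes L: "L \<in> hs_ops H K" and g: "singular_system L g"
  shows "is_eigval_seq H (adj H K L \<circ> L) (\<lambda>i. (norm (L (g i)))\<^sup>2)"
  using singular_decseq[OF L g] singular_finite[OF L g] singular_has_dim[OF L g]
  by (simp add: is_eigval_seq_def gen_eigenspace_adj_comp[OF hs_ops_bounded[OF L]])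

lemma sing_val_eq:
  assumes "is_eigval_seq H (adj H K L \<circ> L) f"
  shows "sing_val H K L i = sqrt (f i)"
  by (simp add: sing_val_def H.eigval_eqI[OF assms])

text \<open>\<open>sing_val\<close> composes its operator with the adjoint once more. For a
  self-adjoint operator this is the square, whose eigenvalue sequence consists of the squares
  \<open>(f i)\<^sup>2\<close>, undone by the root.\<close>

lemma sing_val_adj_comp:
  assumes L: "L \<in> bounded_ops H K" and f: "is_eigval_seq H (adj H K L \<circ> L) f"
  shows "sing_val H H (adj H K L \<circ> L) i = f i"
proof -
  interpret HH: hilbert_pair H H ..
  have "adj H H (adj H K L \<circ> L) = adj H K L \<circ> L"
    by (intro ext HH.adjI adj_comp_selfadj[OF L])
  then show ?thesis
    using H.eigval_eqI[OF is_eigval_seq_adj_comp_sq[OF L f]] f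
    by (simp add: sing_val_def is_eigval_seq_def)
qed

text \<open>\<open>F\<close> maps the one eigenspace bijectively onto the other; the inverse is
  \<open>G\<close> divided by \<open>c\<close>.\<close>

lemma has_dim_eigenspace_swap:
  assumes F: "Vector_Spaces.linear (scal H) (scal K) F" and G: "Vector_Spaces.linear (scal K) (scal H) G"
    and c: "c \<noteq> 0" and dim: "has_dim H {x. G (F x) = scal H c x} n"
  shows "has_dim K {y. F (G y) = scal K c y} n"
proof -
  interpret F: Vector_Spaces.linear "scal H" "scal K" F by fact
  interpret G: Vector_Spaces.linear "scal K" "scal H" G by fact
  let ?V = "{x. G (F x) = scal H c x}"
  obtain S where S: "finite S" "card S = n" "H.independent S" "H.span S = ?V"
    using dim unfolding has_dim_def by blast
  have inj: "inj_on F ?V"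
  proof (rule inj_onI)
    fix x y assume "x \<in> ?V" "y \<in> ?V" "F x = F y"
    then have "scal H c x = scal H c y" by auto
    then show "x = y" using c by simp
  qed
  have "{y. F (G y) = scal K c y} = F ` ?V"
  proof (intro equalityI subsetI)
    fix y assume y: "y \<in> {y. F (G y) = scal K c y}"
    have Fy: "F (scal H (1 / c) (G y)) = y" using y c by (simp add: F.scale)
    then have "scal H (1 / c) (G y) \<in> ?V" using c by simp
    from imageI[OF this, of F] show "y \<in> F ` ?V" by (simp only: Fy)
  qed (auto simp: F.scale)
  moreover have "K.span (F ` S) = F ` ?V" by (simp only: F.span_image S(4))
  moreover have "K.independent (F ` S)"
    using S(3) inj by (intro F.independent_injective_image) (auto simp: S(4))
  moreover have "card (F ` S) = n"
    using inj_on_subset[OF inj] H.span_superset[of S] S(2,4) by (simp add: card_image)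
  ultimately show ?thesis using S(1) unfolding has_dim_def by (intro exI[of _ "F ` S"]) auto
qed

text \<open>Only \<open>F \<circ> G\<close> need be diagonalizable: Jordan chains of \<open>G \<circ> F\<close> are then trivial as well.\<close>

lemma gen_eigenspace_swap:
  assumes F: "Vector_Spaces.linear (scal H) (scal K) F" and G: "Vector_Spaces.linear (scal K) (scal H) G"
    and c: "c \<noteq> 0" and diag: "gen_eigenspace K (F \<circ> G) c = {y. F (G y) = scal K c y}"
  shows "gen_eigenspace H (G \<circ> F) c = {x. G (F x) = scal H c x}"
proof -
  interpret F: Vector_Spaces.linear "scal H" "scal K" F by fact
  interpret G: Vector_Spaces.linear "scal K" "scal H" G by fact
  define D where "D x = G (F x) - scal H c x" for x
  define D' where "D' y = F (G y) - scal K c y" for y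
  have FD: "F ((D ^^ n) x) = (D' ^^ n) (F x)" for n x
    by (induction n) (simp_all add: D_def D'_def F.diff F.scale)
  have "D x = 0" if n: "(D ^^ n) x = 0" for n x
  proof -
    have "(D' ^^ n) (F x) = 0" using FD[of n x] n by simp
    then have "F x \<in> gen_eigenspace K (F \<circ> G) c"
      unfolding gen_eigenspace_def D'_def[abs_def] by auto
    \<comment> \<open>Diagonalizability makes \<open>F x\<close> a true eigenvector, so
      \<open>D\<close> acts on \<open>D x\<close> as multiplication by \<open>- c\<close>. A power
      of \<open>D\<close> that kills \<open>x\<close> then forces \<open>D x = 0\<close>.\<close>
    then have "F (D x) = 0" unfolding diag by (simp add: D_def F.diff F.scale)
    then have Dn: "(D ^^ m) (D x) = scal H ((- c) ^ m) (D x)" for m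
      by (induction m) (simp_all add: D_def F.scale F.diff G.scale)
    have "(D ^^ n) (D x) = D ((D ^^ n) x)" by (simp add: funpow_swap1)
    also have "\<dots> = 0" using n by (simp add: D_def)
    finally show ?thesis using Dn[of n] c by simp
  qed
  then have "gen_eigenspace H (G \<circ> F) c = {x. D x = 0}"
    unfolding gen_eigenspace_def D_def[abs_def] o_apply
    by (auto intro: exI[of _ "1::nat"])
  then show ?thesis by (simp add: D_def)
qed

text \<open>Algebraic linearity carries the whole argument, so it applies to a \<open>G\<close>
  built from a possibly unbounded Moore--Penrose inverse.\<close>

theorem is_eigval_seq_swap:
  assumes F: "Vector_Spaces.linear (scal H) (scal K) F" and G: "Vector_Spaces.linear (scal K) (scal H) G"
    and diag: "\<And>t. t > 0 \<Longrightarrow>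
      gen_eigenspace K (F \<circ> G) (of_real t) = {y. F (G y) = scal K (of_real t) y}"
    and f: "is_eigval_seq K (F \<circ> G) f"
  shows "is_eigval_seq H (G \<circ> F) f"
proof -
  interpret KH: hilbert_pair K H ..
  have "has_dim H (gen_eigenspace H (G \<circ> F) (of_real t)) (card {i. f i = t})" if t: "t > 0" for t
  proof -
    have c: "of_real t \<noteq> (0 :: 'k)" using t by simp
    have "has_dim K {y. F (G y) = scal K (of_real t) y} (card {i. f i = t})"
      using f t by (simp add: is_eigval_seq_def diag)
    then show ?thesis
      unfolding gen_eigenspace_swap[OF F G c diag[OF t]] by (rule KH.has_dim_eigenspace_swap[OF G F c])
  qed
  then show ?thesis using f by (simp add: is_eigval_seq_def)
qed

end

lemma bounded_ops_linear: "T \<in> bounded_ops H K \<Longrightarrow> Vector_Spaces.linear (scal H) (scal K) T"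
  by (simp add: bounded_ops_def)

section \<open>The Moore--Penrose inverse\<close>

context hilbert_pair
begin

context
  fixes T
  assumes T: "T \<in> bounded_ops H K"
begin

lemma pinv_eqI:
  assumes x: "x \<in> orth_compl H (ker T)" and k: "k \<in> orth_compl K (range T)" and y: "y = T x + k"
  shows "pinv H K T y = x"
  unfolding pinv_def
proof (rule the_equality)
  fix x' assume x': "x' \<in> orth_compl H (ker T) \<and> (\<exists>k\<in>orth_compl K (range T). y = T x' + k)"
  then obtain k' where k': "k' \<in> orth_compl K (range T)" "y = T x' + k'" by blast
  have eq: "T (x' - x) = k - k'" using y k'(2) by (simp add: bounded_ops_diff[OF T] algebra_simps)
  have "k - k' \<in> orth_compl K (range T)"
    using K.subspace_diff[OF K.subspace_orth_compl k k'(1)] .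
  then have "T (x' - x) \<in> orth_compl K (range T)" by (simp only: eq)
  then have "T (x' - x) = 0" using K.orth_compl_disjoint by blast
  moreover have "x' - x \<in> orth_compl H (ker T)"
    using H.subspace_diff[OF H.subspace_orth_compl] x x' by blast
  ultimately have "x' - x = 0" by (intro H.orth_compl_disjoint[of _ "ker T"]) (auto simp: ker_def)
  then show "x' = x" by simp
qed (use assms in blast)

lemma orth_compl_orth_compl_ker: "orth_compl H (orth_compl H (ker T)) \<subseteq> ker T"
proof
  fix x assume x: "x \<in> orth_compl H (orth_compl H (ker T))"
  obtain p where p: "p \<in> ker T" "x - p \<in> orth_compl H (ker T)"
    using H.projection_exists[OF ker_subspace[OF T] ker_closed[OF T]] by blast
  have "ip H p (x - p) = 0" using p by (auto simp: orth_compl_def H.ip_eq_0_commute[of p])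
  moreover have "ip H x (x - p) = 0" using x p(2) by (auto simp: orth_compl_def)
  ultimately have "ip H (x - p) (x - p) = 0" by (simp add: H.ip_diff_left)
  then show "x \<in> ker T" using p(1) by (simp add: H.ip_self)
qed

lemma apply_orth_proj_ker: "T (orth_proj H (orth_compl H (ker T)) x) = T x"
proof -
  have "x - orth_proj H (orth_compl H (ker T)) x \<in> ker T"
    using H.orth_proj_diff[OF H.subspace_orth_compl H.closed_orth_compl]
      orth_compl_orth_compl_ker by blast
  then show ?thesis by (simp add: ker_def bounded_ops_diff[OF T])
qed

lemma range_subset_pinv_dom: "range T \<subseteq> pinv_dom H K T"
  unfolding pinv_dom_def using K.subspace_0[OF K.subspace_orth_compl, of "range T"] by force

lemma pinv_apply: "pinv H K T (T x) = orth_proj H (orth_compl H (ker T)) x"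
proof (rule pinv_eqI)
  show "orth_proj H (orth_compl H (ker T)) x \<in> orth_compl H (ker T)"
    by (rule H.orth_proj_in[OF H.subspace_orth_compl H.closed_orth_compl])
  show "0 \<in> orth_compl K (range T)" by (rule K.subspace_0[OF K.subspace_orth_compl])
qed (simp add: apply_orth_proj_ker)

text \<open>The existence behind the definite description: a preimage is replaced by its component
  orthogonal to the kernel, which has the same image.\<close>

lemma pinv_domE:
  assumes "y \<in> pinv_dom H K T"
  obtains k where "pinv H K T y \<in> orth_compl H (ker T)" "k \<in> orth_compl K (range T)"
    "y = T (pinv H K T y) + k"
proof -
  obtain x k where k: "k \<in> orth_compl K (range T)" "y = T x + k"
    using assms by (auto simp: pinv_dom_def)
  let ?p = "orth_proj H (orth_compl H (ker T)) x"
  have p: "?p \<in> orth_compl H (ker T)" "y = T ?p + k"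
    using H.orth_proj_in[OF H.subspace_orth_compl H.closed_orth_compl] k(2)
    by (simp_all add: apply_orth_proj_ker)
  have "pinv H K T y = ?p" by (rule pinv_eqI[OF p(1) k(1) p(2)])
  then show thesis using that p k(1) by metis
qed

lemma apply_pinv:
  assumes y: "y \<in> pinv_dom H K T"
  shows "T (pinv H K T y) = orth_proj K (closure (range T)) y"
proof -
  obtain k where k: "k \<in> orth_compl K (range T)" "y = T (pinv H K T y) + k"
    by (rule pinv_domE[OF y])
  have "orth_proj K (closure (range T)) y = T (pinv H K T y)"
  proof (rule K.orth_projI)
    show "K.subspace (closure (range T))" by (intro K.subspace_closure range_subspace T)
    show "T (pinv H K T y) \<in> closure (range T)" by (rule subsetD[OF closure_subset]) simp
    have "y - T (pinv H K T y) = k" using k(2) by (metis add_diff_cancel_left')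
    then show "y - T (pinv H K T y) \<in> orth_compl K (closure (range T))"
      using k(1) by (simp add: K.orth_compl_closure)
  qed
  then show ?thesis by simp
qed

text \<open>The total function \<open>pinv\<close> has arbitrary values off \<open>pinv_dom\<close>,
  so linearity is available only after a map into that domain. There the defining decompositions can
  be added and scaled, and uniqueness identifies the result.\<close>

lemma pinv_comp_linear:
  assumes S: "Vector_Spaces.linear s (scal K) S" and dom: "range S \<subseteq> pinv_dom H K T"
  shows "Vector_Spaces.linear s (scal H) (pinv H K T \<circ> S)"
proof -
  interpret S: Vector_Spaces.linear s "scal K" S by fact
  have lin: "pinv H K T (S (x + y)) = pinv H K T (S x) + pinv H K T (S y)" for x y
  proof -
    obtain k where k: "pinv H K T (S x) \<in> orth_compl H (ker T)" "k \<in> orth_compl K (range T)"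
      "S x = T (pinv H K T (S x)) + k" using pinv_domE dom by blast
    obtain l where l: "pinv H K T (S y) \<in> orth_compl H (ker T)" "l \<in> orth_compl K (range T)"
      "S y = T (pinv H K T (S y)) + l" using pinv_domE dom by blast
    show ?thesis
    proof (rule pinv_eqI)
      show "S (x + y) = T (pinv H K T (S x) + pinv H K T (S y)) + (k + l)"
        using k(3) l(3) by (metis S.add bounded_ops_add[OF T] add.assoc add.left_commute)
    qed (use k l H.subspace_add[OF H.subspace_orth_compl] K.subspace_add[OF K.subspace_orth_compl] in blast)+
  qed
  have sc: "pinv H K T (S (s c x)) = scal H c (pinv H K T (S x))" for c x
  proof -
    obtain k where k: "pinv H K T (S x) \<in> orth_compl H (ker T)" "k \<in> orth_compl K (range T)"
      "S x = T (pinv H K T (S x)) + k" using pinv_domE dom by blast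
    show ?thesis
    proof (rule pinv_eqI)
      show "S (s c x) = T (scal H c (pinv H K T (S x))) + scal K c k"
        using k(3) by (metis S.scale bounded_ops_scal[OF T] K.scale_right_distrib)
    qed (use k H.subspace_scale[OF H.subspace_orth_compl] K.subspace_scale[OF K.subspace_orth_compl] in blast)+
  qed
  show ?thesis using lin sc S.linear_axioms H.vector_space_axioms by (simp add: Vector_Spaces.linear_iff)
qed

end

end

text \<open>The two projectors cut \<open>M\<close> into three orthogonal parts, and subtracting
  \<open>PYQ\<close> changes only the part \<open>K\<close>. The error there is squeezed:
  compression does not increase the error of the optimal \<open>Y\<close>, while \<open>PYQ\<close>
  still has rank at most \<open>r\<close> and so obeys the Eckart--Young lower bound.\<close>

lemma hs_norm_sq_minus_best_approx:
  assumes H: "hilbert_space H1" "hilbert_space H4"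
    and M: "M \<in> hs_ops H1 H4"
    and V: "module.subspace (scal H4) V" "closed V" and W: "module.subspace (scal H1) W" "closed W"
    and K: "K = orth_proj H4 V \<circ> M \<circ> orth_proj H1 W"
    and Y: "Y \<in> rank_le_ops H1 H4 r"
    and best: "\<And>Z. Z \<in> rank_le_ops H1 H4 r \<Longrightarrow> hs_norm H1 (\<lambda>x. K x - Y x) \<le> hs_norm H1 (\<lambda>x. K x - Z x)"
    and g: "hilbert_pair.singular_system H4 H1 (adj H1 H4 K) g"
  shows "(\<lambda>x. M x - orth_proj H4 V (Y (orth_proj H1 W x))) \<in> hs_ops H1 H4 \<and>
    (hs_norm H1 (\<lambda>x. M x - orth_proj H4 V (Y (orth_proj H1 W x))))\<^sup>2
      = (hs_norm H1 M)\<^sup>2 - (\<Sum>i<r. (norm (adj H1 H4 K (g i)))\<^sup>2)"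
proof -
  interpret H1: hilbert_space H1 by fact
  interpret H4: hilbert_space H4 by fact
  interpret hilbert_pair H1 H4 ..
  define P where "P = orth_proj H4 V"
  define Q where "Q = orth_proj H1 W"
  define PYQ where "PYQ = P \<circ> Y \<circ> Q"
  have PP: "P (P x) = P x" for x
    unfolding P_def by (intro H4.orth_proj_id H4.orth_proj_in V)
  have QQ: "Q (Q x) = Q x" for x
    unfolding Q_def by (intro H1.orth_proj_id H1.orth_proj_in W)
  note bP = H4.orth_proj_bounded_ops[OF V, folded P_def]
  note bQ = H1.orth_proj_bounded_ops[OF W, folded Q_def]
  note left = hs_pythagoras_left[OF _ V, folded P_def]
  note right = hs_pythagoras_right[OF _ W, folded Q_def]
  note Yhs = rank_le_hs_ops[OF Y]
  have K': "K = P \<circ> M \<circ> Q" by (simp add: K P_def Q_def)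
  have Khs: "K \<in> hs_ops H1 H4" unfolding K' by (intro right(1) left(1) M)
  have PYQhs: "PYQ \<in> hs_ops H1 H4" unfolding PYQ_def by (intro right(1) left(1) Yhs)
  have split: "(hs_norm H1 T)\<^sup>2 = (hs_norm H1 (P \<circ> T \<circ> Q))\<^sup>2
      + (hs_norm H1 (\<lambda>x. P (T x) - P (T (Q x))))\<^sup>2 + (hs_norm H1 (\<lambda>x. T x - P (T x)))\<^sup>2"
    if "T \<in> hs_ops H1 H4" for T
    using left(3)[OF that] right(2)[OF left(1)[OF that]] by (simp add: o_def)
  have Dhs: "(\<lambda>x. M x - PYQ x) \<in> hs_ops H1 H4" by (intro hs_ops_sub M PYQhs)
  have "P \<circ> (\<lambda>x. M x - PYQ x) \<circ> Q = (\<lambda>x. K x - PYQ x)"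
    by (auto simp: K' PYQ_def bounded_ops_diff[OF bP] PP QQ)
  moreover have "(\<lambda>x. P (M x - PYQ x) - P (M (Q x) - PYQ (Q x))) = (\<lambda>x. P (M x) - P (M (Q x)))"
    by (auto simp: PYQ_def bounded_ops_diff[OF bP] PP QQ)
  moreover have "(\<lambda>x. M x - PYQ x - P (M x - PYQ x)) = (\<lambda>x. M x - P (M x))"
    by (auto simp: PYQ_def bounded_ops_diff[OF bP] PP)
  ultimately have "(hs_norm H1 (\<lambda>x. M x - PYQ x))\<^sup>2
      = (hs_norm H1 M)\<^sup>2 - (hs_norm H1 K)\<^sup>2 + (hs_norm H1 (\<lambda>x. K x - PYQ x))\<^sup>2"
    using split[OF Dhs] split[OF M] by (simp add: K')
  moreover have "(hs_norm H1 (\<lambda>x. K x - PYQ x))\<^sup>2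
      = (hs_norm H1 K)\<^sup>2 - (\<Sum>i<r. (norm (adj H1 H4 K (g i)))\<^sup>2)"
  proof (rule antisym)
    have hs: "(\<lambda>x. K x - Y x) \<in> hs_ops H1 H4" by (intro hs_ops_sub Khs Yhs)
    have "P \<circ> (\<lambda>x. K x - Y x) \<circ> Q = (\<lambda>x. K x - PYQ x)"
      by (auto simp: K' PYQ_def bounded_ops_diff[OF bP] PP QQ)
    then have "(hs_norm H1 (\<lambda>x. K x - PYQ x))\<^sup>2 \<le> (hs_norm H1 (\<lambda>x. K x - Y x))\<^sup>2"
      using split[OF hs] by simp
    also obtain Z where Z: "Z \<in> rank_le_ops H1 H4 r" "(hs_norm H1 (\<lambda>x. K x - Z x))\<^sup>2
      = (hs_norm H1 K)\<^sup>2 - (\<Sum>i<r. (norm (adj H1 H4 K (g i)))\<^sup>2)"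
      using eckart_young(1)[OF Khs g] by blast
    have "(hs_norm H1 (\<lambda>x. K x - Y x))\<^sup>2 \<le> (hs_norm H1 (\<lambda>x. K x - Z x))\<^sup>2"
      using best[OF Z(1)] by (intro power_mono hs_norm_nonneg)
    finally show "(hs_norm H1 (\<lambda>x. K x - PYQ x))\<^sup>2
      \<le> (hs_norm H1 K)\<^sup>2 - (\<Sum>i<r. (norm (adj H1 H4 K (g i)))\<^sup>2)" by (simp only: Z(2))
    have "PYQ \<in> rank_le_ops H1 H4 r"
    proof -
      obtain F where F: "finite F" "card F \<le> r" "H4.onf F (\<lambda>f. f)" "range Y \<subseteq> H4.span F"
        by (rule rank_le_spanD[OF Y])
      interpret P: Vector_Spaces.linear "scal H4" "scal H4" P by (rule bounded_ops_linear[OF bP])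
      have "P ` range Y \<subseteq> H4.span (P ` F)" unfolding P.span_image using F(4) by (rule image_mono)
      then have "range PYQ \<subseteq> H4.span (P ` F)" by (auto simp: PYQ_def)
      then show ?thesis
        using hs_ops_bounded[OF PYQhs] F(1,2) card_image_le[OF F(1), of P]
        by (intro rank_le_opsI[of _ "P ` F"]) auto
    qed
    then show "(hs_norm H1 K)\<^sup>2 - (\<Sum>i<r. (norm (adj H1 H4 K (g i)))\<^sup>2)
      \<le> (hs_norm H1 (\<lambda>x. K x - PYQ x))\<^sup>2"
      by (rule eckart_young(2)[OF Khs g])
  qed
  ultimately have "(hs_norm H1 (\<lambda>x. M x - PYQ x))\<^sup>2
      = (hs_norm H1 M)\<^sup>2 - (\<Sum>i<r. (norm (adj H1 H4 K (g i)))\<^sup>2)" by simp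
  with Dhs show ?thesis by (simp add: PYQ_def P_def Q_def)
qed

theorem proposition3p11:
  fixes H1 :: "('k::real_or_complex, 'a::banach) hilbert"
    and H2 :: "('k, 'b::banach) hilbert"
    and H3 :: "('k, 'c::banach) hilbert"
    and H4 :: "('k, 'd::banach) hilbert"
    and r :: nat
    and M K :: "'a \<Rightarrow> 'd" and B :: "'c \<Rightarrow> 'd" and C :: "'a \<Rightarrow> 'b"
    and PB :: "'d \<Rightarrow> 'd" and \<Delta> :: real
  assumes "hilbert_space H1" "separable_space (euclidean :: 'a topology)"
    and "hilbert_space H2" "separable_space (euclidean :: 'b topology)"
    and "hilbert_space H3" "separable_space (euclidean :: 'c topology)"
    and "hilbert_space H4" "separable_space (euclidean :: 'd topology)"
    and "M \<in> hs_ops H1 H4"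
    and "B \<in> bounded_ops H3 H4"
    and "C \<in> bounded_ops H1 H2"
    and PB: "PB = orth_proj H4 (closure (range B))"
    and K: "K = PB \<circ> M \<circ> orth_proj H1 (orth_compl H1 (ker C))"
    and "best_approx H1 H3 H4 r B K \<noteq> {}"
    and Delta: "\<Delta> = (\<Sum>i<r. \<bar>sing_val H1 H4 K i\<bar>\<^sup>2)"
  shows "(\<forall>Y X. Y \<in> best_approx H1 H3 H4 r B K \<longrightarrow>
            (\<forall>y\<in>pinv_dom H1 H2 C. X y = pinv H3 H4 B (Y (pinv H1 H2 C y))) \<longrightarrow>
            (\<lambda>x. M x - B (X (C x))) \<in> hs_ops H1 H4 \<and>
            (hs_norm H1 (\<lambda>x. M x - B (X (C x))))\<^sup>2 = (hs_norm H1 M)\<^sup>2 - \<Delta>) \<and>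
         \<Delta> = (\<Sum>i<r. sing_val H4 H4
                  (PB \<circ> M \<circ> pinv H1 H2 C \<circ> C \<circ> adj H1 H4 M \<circ> PB) i) \<and>
         \<Delta> = (\<Sum>i<r. sing_val H1 H1
                  (pinv H1 H2 C \<circ> C \<circ> adj H1 H4 M \<circ> PB \<circ> M \<circ> pinv H1 H2 C \<circ> C) i) \<and>
         (range M \<subseteq> pinv_dom H3 H4 B \<longrightarrow>
            (\<forall>\<mu>. is_eigenvalue H3
                    (pinv H3 H4 B \<circ> M \<circ> pinv H1 H2 C \<circ> C \<circ> adj H1 H4 M \<circ> B) \<mu> \<longrightarrow>
                  (\<exists>t\<ge>0. \<mu> = of_real t)) \<and>
            \<Delta> = (\<Sum>i<r. eigval H3
                    (pinv H3 H4 B \<circ> M \<circ> pinv H1 H2 C \<circ> C \<circ> adj H1 H4 M \<circ> B) i))"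
proof -
  interpret H1: hilbert_space H1 by fact
  interpret H2: hilbert_space H2 by fact
  interpret H3: hilbert_space H3 by fact
  interpret H4: hilbert_space H4 by fact
  interpret P12: hilbert_pair H1 H2 ..
  interpret P14: hilbert_pair H1 H4 ..
  interpret P41: hilbert_pair H4 H1 ..
  interpret P34: hilbert_pair H3 H4 ..
  interpret P31: hilbert_pair H3 H1 ..
  note M = \<open>M \<in> hs_ops H1 H4\<close>
  note B = \<open>B \<in> bounded_ops H3 H4\<close>
  note C = \<open>C \<in> bounded_ops H1 H2\<close>
  note Mb = hs_ops_bounded[OF M]
  define Q where "Q = orth_proj H1 (orth_compl H1 (ker C))"
  have V: "H4.subspace (closure (range B))" "closed (closure (range B))"
    by (auto intro: H4.subspace_closure P34.range_subspace B)
  have W: "H1.subspace (orth_compl H1 (ker C))" "closed (orth_compl H1 (ker C))"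
    by (rule H1.subspace_orth_compl H1.closed_orth_compl)+
  have PP: "PB (PB x) = PB x" for x
    unfolding PB by (intro H4.orth_proj_id H4.orth_proj_in V)
  have QQ: "Q (Q x) = Q x" for x
    unfolding Q_def by (intro H1.orth_proj_id H1.orth_proj_in W)
  note bP = H4.orth_proj_bounded_ops[OF V, folded PB]
  note bQ = H1.orth_proj_bounded_ops[OF W, folded Q_def]
  have CC: "pinv H1 H2 C (C x) = Q x" for x
    unfolding Q_def by (rule P12.pinv_apply[OF C])
  have K': "K = PB \<circ> M \<circ> Q" by (simp add: K Q_def)
  have Khs: "K \<in> hs_ops H1 H4"
    unfolding K PB by (intro P14.hs_pythagoras_right(1) P14.hs_pythagoras_left(1) M V W)
  note Kb = hs_ops_bounded[OF Khs]
  note Ab = P14.adj_bounded_ops[OF Kb]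
  have adjK: "adj H1 H4 K = Q \<circ> adj H1 H4 M \<circ> PB"
    by (intro ext P14.adjI)
      (simp add: K' PB Q_def H4.orth_proj_selfadj[OF V] H1.orth_proj_selfadj[OF W] P14.adj_ip[OF Mb])
  have adjadjK: "adj H4 H1 (adj H1 H4 K) = K"
    by (rule adj_adj[OF P14.hilbert_pair_axioms Kb])
  obtain g where g: "P41.singular_system (adj H1 H4 K) g"
    using P41.singular_system_exists[OF P14.adj_hs(1)[OF Khs]] by blast
  \<comment> \<open>One sequence serves all operators of the theorem: it lists the eigenvalues of
    \<open>K \<circ> adj H1 H4 K\<close>, of the reverse product and later of
    \<open>G \<circ> F\<close>.\<close>
  define f where "f i = (norm (adj H1 H4 K (g i)))\<^sup>2" for i
  have f4: "is_eigval_seq H4 (K \<circ> adj H1 H4 K) f"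
    using P41.singular_is_eigval_seq[OF P14.adj_hs(1)[OF Khs] g]
    by (simp add: adjadjK f_def[abs_def])
  have f1: "is_eigval_seq H1 (adj H1 H4 K \<circ> K) f"
    using P41.gen_eigenspace_adj_comp[OF Ab]
    by (intro P14.is_eigval_seq_swap bounded_ops_linear Kb Ab f4) (simp add: adjadjK H4.scal_of_real)
  have f_nonneg: "0 \<le> f i" for i by (simp add: f_def)
  have \<Delta>: "\<Delta> = (\<Sum>i<r. f i)"
    using f_nonneg by (simp add: Delta P14.sing_val_eq[OF f1])

  have 1: "(\<lambda>x. M x - B (X (C x))) \<in> hs_ops H1 H4 \<and>
      (hs_norm H1 (\<lambda>x. M x - B (X (C x))))\<^sup>2 = (hs_norm H1 M)\<^sup>2 - \<Delta>"
    if Y: "Y \<in> best_approx H1 H3 H4 r B K"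
      and X: "\<forall>y\<in>pinv_dom H1 H2 C. X y = pinv H3 H4 B (Y (pinv H1 H2 C y))" for X Y
  proof -
    have "B (X (C x)) = PB (Y (Q x))" for x
    proof -
      \<comment> \<open>\<open>X\<close> is prescribed only on the domain of the inverse of
        \<open>C\<close>, which contains every \<open>C x\<close>.\<close>
      have "C x \<in> pinv_dom H1 H2 C" using P12.range_subset_pinv_dom[OF C] by blast
      then have "X (C x) = pinv H3 H4 B (Y (Q x))" using X by (simp add: CC)
      moreover have "Y (Q x) \<in> pinv_dom H3 H4 B" using Y by (auto simp: best_approx_def)
      ultimately show ?thesis by (simp add: P34.apply_pinv[OF B] PB)
    qed
    moreover have "(\<lambda>x. M x - PB (Y (Q x))) \<in> hs_ops H1 H4 \<and>
      (hs_norm H1 (\<lambda>x. M x - PB (Y (Q x))))\<^sup>2 = (hs_norm H1 M)\<^sup>2 - (\<Sum>i<r. f i)"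
      unfolding PB Q_def f_def
    proof (rule hs_norm_sq_minus_best_approx[OF H1.hilbert_space_axioms H4.hilbert_space_axioms M V W])
      show "K = orth_proj H4 (closure (range B)) \<circ> M \<circ> orth_proj H1 (orth_compl H1 (ker C))"
        by (simp only: K PB)
      show "Y \<in> rank_le_ops H1 H4 r" using Y by (simp add: best_approx_def)
      show "hs_norm H1 (\<lambda>x. K x - Y x) \<le> hs_norm H1 (\<lambda>x. K x - Z x)"
        if "Z \<in> rank_le_ops H1 H4 r" for Z using Y that by (simp add: best_approx_def)
    qed (rule g)
    ultimately show ?thesis by (simp add: \<Delta>)
  qed

  have "PB \<circ> M \<circ> pinv H1 H2 C \<circ> C \<circ> adj H1 H4 M \<circ> PB
      = adj H4 H1 (adj H1 H4 K) \<circ> adj H1 H4 K"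
    unfolding adjadjK unfolding adjK unfolding K' by (simp add: fun_eq_iff CC QQ)
  then have 2: "\<Delta> = (\<Sum>i<r. sing_val H4 H4
      (PB \<circ> M \<circ> pinv H1 H2 C \<circ> C \<circ> adj H1 H4 M \<circ> PB) i)"
    using f4 by (simp only: P41.sing_val_adj_comp[OF Ab, unfolded adjadjK] adjadjK \<Delta>)

  have adjKK: "adj H1 H4 K \<circ> K = Q \<circ> adj H1 H4 M \<circ> PB \<circ> M \<circ> Q"
    unfolding adjK unfolding K' by (simp add: fun_eq_iff PP)
  have "pinv H1 H2 C \<circ> C \<circ> adj H1 H4 M \<circ> PB \<circ> M \<circ> pinv H1 H2 C \<circ> C
      = adj H1 H4 K \<circ> K"
    by (simp add: adjKK fun_eq_iff CC)
  then have 3: "\<Delta> = (\<Sum>i<r. sing_val H1 H1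
      (pinv H1 H2 C \<circ> C \<circ> adj H1 H4 M \<circ> PB \<circ> M \<circ> pinv H1 H2 C \<circ> C) i)"
    using f1 by (simp only: P14.sing_val_adj_comp[OF Kb] \<Delta>)

  have 4: "(\<forall>\<mu>. is_eigenvalue H3
        (pinv H3 H4 B \<circ> M \<circ> pinv H1 H2 C \<circ> C \<circ> adj H1 H4 M \<circ> B) \<mu> \<longrightarrow>
        (\<exists>t\<ge>0. \<mu> = of_real t)) \<and>
      \<Delta> = (\<Sum>i<r. eigval H3
        (pinv H3 H4 B \<circ> M \<circ> pinv H1 H2 C \<circ> C \<circ> adj H1 H4 M \<circ> B) i)"
    if dom: "range M \<subseteq> pinv_dom H3 H4 B"
  proof -
    define F where "F = Q \<circ> adj H1 H4 M \<circ> B"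
    define G where "G = pinv H3 H4 B \<circ> (M \<circ> Q)"
    have GF: "pinv H3 H4 B \<circ> M \<circ> pinv H1 H2 C \<circ> C \<circ> adj H1 H4 M \<circ> B = G \<circ> F"
      by (simp add: fun_eq_iff F_def G_def CC QQ)
    \<comment> \<open>The assumption on \<open>range M\<close> allows replacing \<open>B\<close>
      after its Moore--Penrose inverse by \<open>PB\<close> on values of \<open>M\<close>.\<close>
    have FG: "F \<circ> G = adj H1 H4 K \<circ> K"
      unfolding adjKK using dom
      by (auto simp: fun_eq_iff F_def G_def PB intro!: arg_cong[of _ _ Q] arg_cong[of _ _ "adj H1 H4 M"]
          P34.apply_pinv[OF B])
    have F: "Vector_Spaces.linear (scal H3) (scal H1) F"
      unfolding F_def
      by (rule bounded_ops_linear[OF bounded_ops_comp[OF B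
              bounded_ops_comp[OF P14.adj_bounded_ops[OF Mb] bQ]]])
    have G: "Vector_Spaces.linear (scal H1) (scal H3) G"
      unfolding G_def
      by (rule P34.pinv_comp_linear[OF B bounded_ops_linear[OF bounded_ops_comp[OF bQ Mb]]])
        (use dom in auto)
    have FG_apply: "F (G y) = adj H1 H4 K (K y)" for y using fun_cong[OF FG, of y] by simp
    have "is_eigval_seq H3 (G \<circ> F) f"
      using P14.gen_eigenspace_adj_comp[OF Kb] f1
      by (intro P31.is_eigval_seq_swap F G) (simp_all add: FG FG_apply H1.scal_of_real)
    then have "\<Delta> = (\<Sum>i<r. eigval H3 (G \<circ> F) i)" by (simp add: H3.eigval_eqI \<Delta>)
    moreover have "\<exists>t\<ge>0. \<mu> = of_real t" if \<mu>: "is_eigenvalue H3 (G \<circ> F) \<mu>" for \<mu>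
    proof (cases "\<mu> = 0")
      case True
      then show ?thesis by (intro exI[of _ 0]) simp
    next
      case False
      interpret F: Vector_Spaces.linear "scal H3" "scal H1" F by fact
      interpret G: Vector_Spaces.linear "scal H1" "scal H3" G by fact
      obtain x where x: "x \<noteq> 0" "G (F x) = scal H3 \<mu> x" using \<mu> by (auto simp: is_eigenvalue_def)
      \<comment> \<open>\<open>F x\<close> is an eigenvector of the positive operator
        \<open>adj H1 H4 K \<circ> K\<close>, nonzero because \<open>G\<close> maps it to
        \<open>\<mu>\<close> times \<open>x\<close>; so \<open>\<mu>\<close> is a nonnegative
        Rayleigh quotient.\<close>
      define y where "y = F x"
      have y: "y \<noteq> 0" using x False by (auto simp: y_def)
      have "adj H1 H4 K (K y) = scal H1 \<mu> y"
        using x(2) by (simp add: y_def F.scale flip: FG_apply)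
      then have "of_real ((norm (K y))\<^sup>2) = \<mu> * of_real ((norm y)\<^sup>2)"
        using P14.adj_ip_left[OF Kb, of "K y" y] by (simp add: H1.ip_scal_left H1.ip_self H4.ip_self)
      then have "\<mu> = of_real ((norm (K y))\<^sup>2 / (norm y)\<^sup>2)" using y by (simp add: field_simps)
      then show ?thesis by (intro exI[of _ "(norm (K y))\<^sup>2 / (norm y)\<^sup>2"]) simp
    qed
    ultimately show ?thesis unfolding GF by blast
  qed

  show ?thesis using 1 2 3 4 by blast
qed

end
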